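(* Let $x^0\in\mathbb R^d$ and fix $i\in\{1,2\}$. Then $\mathcal N_{\tau_i}:L^\infty((0,T);\mathbb R^k)\to\mathcal S_d^+(\mathbb R)$ is globally Lipschitz: for all $u,v\in L^\infty((0,T);\mathbb R^k)$, $$\|\mathcal N_{\tau_1}(u)-\mathcal N_{\tau_1}(v)\|\le\frac{\Gamma_2\|B\|_\infty^3}{6}\left(3e^{\Gamma_1T}+1\right)\left(\frac{e^{\Gamma_1T}-1}{\Gamma_1}\right)^3\|u-v\|_\infty,$$ $$\|\mathcal N_{\tau_2}(u)-\mathcal N_{\tau_2}(v)\|\le\begin{cases}\dfrac{\Gamma_2\|B\|_\infty^3}{3}\left(\dfrac{e^{\Gamma T}-1}{\Gamma}\right)^3\|u-v\|_\infty&\text{if }\Gamma\neq0,\\[2mm]\dfrac{\Gamma_2\|B\|_\infty^3T^3}{3}\|u-v\|_\infty&\text{if }\Gamma=0.\end{cases}$$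
   Context: $T>0$; $\|\cdot\|$ is the spectral norm of matrices (operator norm for multilinear maps); $\mathcal S_d^+(\mathbb R)$ is the set of real symmetric positive semi-definite $d\times d$ matrices. The Hopfield-type vector field is $N(x)=-Dx+W\sigma(x)$, $x\in\mathbb R^d$, with $D\in\mathbb R^{d\times d}$ diagonal and positive, $W\in\mathbb R^{d\times d}$ constant, and $\sigma(x)=(\sigma_1(x_1),\dots,\sigma_d(x_d))^\top$, where each $\sigma_j:\mathbb R\to\mathbb R$ is of sigmoid type (e.g. $\sigma_j=\tanh$), infinitely differentiable and globally bounded together with all its derivatives. $\phi_t$, $t\in\mathbb R$, is the flow of $N$. The input matrix $B\in L^\infty((0,T);\mathbb R^{d\times k})$ depends only on time, and $\|B\|_\infty$ is the essential supremum of its spectral norm. For $u\in L^\infty((0,T);\mathbb R^k)$, $x_u$ solves $\dot x(t)=N(x(t))+B(t)u(t)$, $x(0)=x^0$, and with $\tau_1:=0$, $\tau_2:=T$, $$\mathcal N_{\tau_i}(u)=\int_0^TD\phi_{\tau_i-t}(x_u(t))B(t)B(t)^\top D\phi_{\tau_i-t}(x_u(t))^\top dt.$$ Constants: $\|\sigma'\|_\infty:=\sup_{x\in\mathbb R^d}\|W\,D\sigma(x)\|$, $\Gamma:=-\lambda_{\min}(D)+\|\sigma'\|_\infty$, $\Gamma_1:=\lambda_{\max}(D)+\|\sigma'\|_\infty$, $\Gamma_2:=\sup_{x\in\mathbb R^d}\|W\,D^2\sigma(x)\|$, where $\lambda_{\min}(D),\lambda_{\max}(D)$ are the smallest and largest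 eigenvalues of $D$. *)

theory Defs
  imports "HOL-Analysis.Analysis" "HOL-Probability.Essential_Supremum"
begin

text \<open>The norm of the type \<open>real ^ 'n ^ 'm\<close> is the Frobenius norm, so the spectral norm
  (the operator norm for Euclidean norms) has to be written explicitly.\<close>

definition spectral_norm :: "real ^ 'n ^ 'm \<Rightarrow> real" where
  "spectral_norm A = onorm (\<lambda>x. A *v x)"

definition bilinear_onorm ::
    "('a::real_normed_vector \<Rightarrow> 'b::real_normed_vector \<Rightarrow> 'c::real_normed_vector) \<Rightarrow> real" where
  "bilinear_onorm \<beta> = (SUP (h, k). norm (\<beta> h k) / (norm h * norm k))"

definition eigenvalues :: "real ^ 'n ^ 'n \<Rightarrow> real set" where
  "eigenvalues A = {l. \<exists>v. v \<noteq> 0 \<and> A *v v = l *\<^sub>R v}"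

definition lambda_min :: "real ^ 'n ^ 'n \<Rightarrow> real" where
  "lambda_min A = Min (eigenvalues A)"

definition lambda_max :: "real ^ 'n ^ 'n \<Rightarrow> real" where
  "lambda_max A = Max (eigenvalues A)"

definition sym_psd :: "(real ^ 'n ^ 'n) set" where
  "sym_psd = {A. transpose A = A \<and> (\<forall>x. 0 \<le> x \<bullet> (A *v x))}"

definition diagonal_positive :: "real ^ 'n ^ 'n \<Rightarrow> bool" where
  "diagonal_positive A \<longleftrightarrow> (\<forall>i j. i \<noteq> j \<longrightarrow> A $ i $ j = 0) \<and> (\<forall>i. 0 < A $ i $ i)"

text \<open>Elements of \<open>L\<^sup>\<infinity>\<close> are given by representatives, defined on all of \<open>real\<close>; their values
  outside of \<open>(0, T)\<close> are irrelevant. The norm \<open>\<nu>\<close> of the target space is a parameter.\<close>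

definition Linf_norm :: "('a \<Rightarrow> real) \<Rightarrow> real \<Rightarrow> (real \<Rightarrow> 'a::euclidean_space) \<Rightarrow> real" where
  "Linf_norm \<nu> T f = real_of_ereal (esssup (lebesgue_on {0<..<T}) (\<lambda>t. ereal (\<nu> (f t))))"

definition Linf :: "('a \<Rightarrow> real) \<Rightarrow> real \<Rightarrow> (real \<Rightarrow> 'a::euclidean_space) set" where
  "Linf \<nu> T = {f \<in> borel_measurable (lebesgue_on {0<..<T}).
     esssup (lebesgue_on {0<..<T}) (\<lambda>t. ereal (\<nu> (f t))) < \<infinity>}"

definition smooth_bounded :: "(real \<Rightarrow> real) \<Rightarrow> bool" where
  "smooth_bounded f \<longleftrightarrow>
     (\<forall>n. (\<forall>x. (deriv ^^ n) f differentiable at x) \<and> bounded (range ((deriv ^^ n) f)))"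

definition componentwise :: "('n \<Rightarrow> real \<Rightarrow> real) \<Rightarrow> real ^ 'n \<Rightarrow> real ^ 'n" where
  "componentwise \<sigma> x = (\<chi> j. \<sigma> j (x $ j))"

definition hopfield ::
    "real ^ 'n ^ 'n \<Rightarrow> real ^ 'n ^ 'n \<Rightarrow> ('n \<Rightarrow> real \<Rightarrow> real) \<Rightarrow> real ^ 'n \<Rightarrow> real ^ 'n" where
  "hopfield D W \<sigma> x = - (D *v x) + W *v componentwise \<sigma> x"

text \<open>\<open>flow N t x\<close> is the value at time \<open>t\<close> (of either sign) of the integral curve of \<open>N\<close>
  that starts in \<open>x\<close>. It is meaningful if \<open>N\<close> is globally Lipschitz, as the Hopfield vector
  field is.\<close>

definition flow ::
    "('a::real_normed_vector \<Rightarrow> 'a) \<Rightarrow> real \<Rightarrow> 'a \<Rightarrow> 'a" where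
  "flow N t x =
     (THE z. z 0 = x \<and> (\<forall>s. (z has_vector_derivative N (z s)) (at s))) t"

definition second_derivative ::
    "('a::real_normed_vector \<Rightarrow> 'b::real_normed_vector) \<Rightarrow> 'a \<Rightarrow> 'a \<Rightarrow> 'a \<Rightarrow> 'b" where
  "second_derivative f x h k =
     frechet_derivative (\<lambda>y. frechet_derivative f (at y) h) (at x) k"

text \<open>Since the control is merely measurable, solutions are understood in the sense of
  Caratheodory, i.e. as continuous solutions of the integral equation.\<close>

definition solves_control ::
    "(real ^ 'n \<Rightarrow> real ^ 'n) \<Rightarrow> (real \<Rightarrow> real ^ 'k ^ 'n) \<Rightarrow> real \<Rightarrow> real ^ 'n \<Rightarrow>
     (real \<Rightarrow> real ^ 'k) \<Rightarrow> (real \<Rightarrow> real ^ 'n) \<Rightarrow> bool" where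
  "solves_control N B T x0 u x \<longleftrightarrow>
     continuous_on {0..T} x \<and>
     (\<forall>t\<in>{0..T}. x t = x0 + (LINT s:{0..t}|lebesgue. N (x s) + B s *v u s))"

text \<open>The solution is unique on \<open>[0, T]\<close> only, hence \<open>SOME\<close> instead of \<open>THE\<close>.\<close>

definition trajectory ::
    "(real ^ 'n \<Rightarrow> real ^ 'n) \<Rightarrow> (real \<Rightarrow> real ^ 'k ^ 'n) \<Rightarrow> real \<Rightarrow> real ^ 'n \<Rightarrow>
     (real \<Rightarrow> real ^ 'k) \<Rightarrow> real \<Rightarrow> real ^ 'n" where
  "trajectory N B T x0 u = (SOME x. solves_control N B T x0 u x)"

definition gramian ::
    "(real ^ 'n \<Rightarrow> real ^ 'n) \<Rightarrow> (real \<Rightarrow> real ^ 'k ^ 'n) \<Rightarrow> real \<Rightarrow> real ^ 'n \<Rightarrow>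
     real \<Rightarrow> (real \<Rightarrow> real ^ 'k) \<Rightarrow> real ^ 'n ^ 'n" where
  "gramian N B T x0 \<tau> u =
     (LINT t:{0..T}|lebesgue.
        (let J = jacobian (flow N (\<tau> - t)) (at (trajectory N B T x0 u t))
         in J ** B t ** transpose (B t) ** transpose J))"

definition sigma'_sup :: "real ^ 'n ^ 'n \<Rightarrow> ('n \<Rightarrow> real \<Rightarrow> real) \<Rightarrow> real" where
  "sigma'_sup W \<sigma> = (SUP x. spectral_norm (W ** jacobian (componentwise \<sigma>) (at x)))"

definition hopfield_Gamma :: "real ^ 'n ^ 'n \<Rightarrow> real ^ 'n ^ 'n \<Rightarrow> ('n \<Rightarrow> real \<Rightarrow> real) \<Rightarrow> real" where
  "hopfield_Gamma D W \<sigma> = - lambda_min D + sigma'_sup W \<sigma>"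

definition hopfield_Gamma1 :: "real ^ 'n ^ 'n \<Rightarrow> real ^ 'n ^ 'n \<Rightarrow> ('n \<Rightarrow> real \<Rightarrow> real) \<Rightarrow> real" where
  "hopfield_Gamma1 D W \<sigma> = lambda_max D + sigma'_sup W \<sigma>"

definition hopfield_Gamma2 :: "real ^ 'n ^ 'n \<Rightarrow> ('n \<Rightarrow> real \<Rightarrow> real) \<Rightarrow> real" where
  "hopfield_Gamma2 W \<sigma> =
     (SUP x. bilinear_onorm (\<lambda>h k. W *v second_derivative (componentwise \<sigma>) x h k))"

end

theory Submission
  imports Defs
begin

text \<open>The two time directions are one situation. The flow of \<open>N\<close> at a negative time is the flow of \<open>- N\<close>
at the opposite positive time (\<open>flow_reversed\<close>), so it suffices to study a \<open>C\<^sup>1\<close> vector field at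
times \<open>t \<ge> 0\<close> in terms of three constants: a bound \<open>a\<close> on the logarithmic norm
\<open>h \<bullet> DN(x) h \<le> a \<bar>h\<bar>\<^sup>2\<close>, a bound \<open>L\<close> on \<open>\<parallel>DN\<parallel>\<close> and a Lipschitz constant \<open>K\<close> of \<open>DN\<close>
(locale \<open>smooth_field\<close>). For the Hopfield field these are \<open>\<Gamma>\<close>, \<open>\<Gamma>\<^sub>1\<close> and \<open>\<Gamma>\<^sub>2\<close>; for its reversal only
\<open>\<Gamma>\<^sub>1\<close> is available as logarithmic norm (\<open>smooth_field_hopfield\<close>, \<open>reversed\<close>).

Everything rests on one comparison principle (\<open>logarithmic_norm_growth\<close>): a curve whose velocity is
a part \<open>F\<close> with \<open>z \<bullet> F \<le> a \<bar>z\<bar>\<^sup>2\<close> plus a perturbation of size \<open>b\<close> has a norm below the solution of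
\<open>m' = a m + b\<close>. With \<open>E\<^sub>a(t) = \<integral>\<^sub>0\<^sup>t e\<^sup>a\<^sup>s ds\<close>, written \<open>expint a t\<close>, it yields

  \<^item> \<open>\<bar>x\<^sub>u(t) - x\<^sub>v(t)\<bar> \<le> \<parallel>B\<parallel> \<parallel>u - v\<parallel> E\<^sub>\<Gamma>(t)\<close> for the trajectories (\<open>trajectory_dist\<close>),
  \<^item> \<open>\<parallel>D\<phi>\<^sub>s\<parallel> \<le> e\<^sup>a\<^sup>s\<close> for the solution \<open>D\<phi>\<^sub>s\<close> of the variational equation (\<open>norm_variation_le\<close>),
  \<^item> \<open>\<parallel>D\<phi>\<^sub>s(x) - D\<phi>\<^sub>s(y)\<parallel> \<le> K \<bar>x - y\<bar> e\<^sup>a\<^sup>s E\<^sub>a(s)\<close>, because the difference solves the variational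
    equation with a forcing of size \<open>K \<bar>x - y\<bar> e\<^sup>2\<^sup>a\<^sup>s\<close> (\<open>variation_dist\<close>).

The difference of the two integrands \<open>J B B\<^sup>T J\<^sup>T\<close> is at most
\<open>\<parallel>J\<^sub>u - J\<^sub>v\<parallel> \<parallel>B\<parallel>\<^sup>2 (\<parallel>J\<^sub>u\<parallel> + \<parallel>J\<^sub>v\<parallel>)\<close>, so the Gramians differ by at most \<open>K \<parallel>B\<parallel>\<^sup>3 \<parallel>u - v\<parallel>\<close> times the
integral over \<open>[0, T]\<close> of \<open>2 e\<^sup>2\<^sup>a\<^sup>s E\<^sub>a(s) E\<^sub>\<Gamma>(t)\<close>, where \<open>s\<close> is \<open>T - t\<close> for the final time and \<open>t\<close> for the
initial time (\<open>gram_along_trajectory_diff_le\<close>). Both integrals are elementary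
(\<open>has_integral_forward_kernel\<close>, \<open>has_integral_backward_kernel\<close>; in the second, \<open>E\<^sub>\<Gamma>\<close> is first enlarged
to \<open>E\<close> with the index \<open>\<Gamma>\<^sub>1\<close>) and are exactly the constants of the theorem.

The flow, its differentiability and the trajectories have to be constructed first. One Picard theorem
(\<open>picard_global\<close>) gives the flow, the solutions of the variational equation and, after subtracting
the continuous function \<open>\<integral> B u\<close>, the Caratheodory solutions of the control system.
\<close>

section \<open>Differential inequalities for norms\<close>

lemma vector_derivative_linearization:
  fixes f :: "real \<Rightarrow> 'a::real_normed_vector"
  assumes "(f has_vector_derivative D) (at t within S)" "0 < e"
  shows "\<forall>\<^sub>F s in at t within S. norm (f s - f t - (s - t) *\<^sub>R D) \<le> e * \<bar>s - t\<bar>"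
proof -
  obtain d where "0 < d"
    and d: "\<And>s. s \<in> S \<Longrightarrow> norm (s - t) < d \<Longrightarrow> norm (f s - f t - (s - t) *\<^sub>R D) \<le> e * norm (s - t)"
    using assms unfolding has_vector_derivative_def has_derivative_within_alt by meson
  then show ?thesis
    unfolding eventually_at by (intro exI[of _ d]) (auto simp: dist_norm)
qed

text \<open>For \<open>e > 0\<close>, the last point up to which \<open>g\<close> lies below the line of slope \<open>e\<close> through \<open>g a\<close>
cannot be before \<open>b\<close>, since the hypothesis lets the bound continue a little further to the right.\<close>

lemma nonincreasing_if_dini_nonpos:
  fixes g :: "real \<Rightarrow> real"
  assumes "continuous_on {a..b} g" "a \<le> b"
    and dini: "\<And>t e. a \<le> t \<Longrightarrow> t < b \<Longrightarrow> 0 < e \<Longrightarrow> \<forall>\<^sub>F s in at_right t. g s \<le> g t + e * (s - t)"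
  shows "g b \<le> g a"
proof (rule field_le_epsilon)
  fix e' :: real assume "0 < e'"
  define e where "e = e' / (b - a + 1)"
  have "0 < e" using \<open>0 < e'\<close> \<open>a \<le> b\<close> by (simp add: e_def)
  define S where "S = {t \<in> {a..b}. g t - e * (t - a) \<le> g a}"
  have "closed S"
    unfolding S_def using assms(1)
    by (intro continuous_closed_preimage_constant continuous_on_closed_Collect_le
        continuous_intros) auto
  moreover have "a \<in> S" using \<open>a \<le> b\<close> by (simp add: S_def)
  moreover have bdd: "bdd_above S" by (rule bdd_aboveI[of _ b]) (auto simp: S_def)
  ultimately have c: "Sup S \<in> S" by (intro closed_contains_Sup) auto
  have "Sup S = b"
  proof (rule ccontr)
    assume "Sup S \<noteq> b"
    with c have lt: "a \<le> Sup S" "Sup S < b" by (auto simp: S_def)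
    have "\<forall>\<^sub>F s in at_right (Sup S). s < b"
      using lt(2) by (simp add: eventually_at_right_field) (use lt(2) in auto)
    moreover have "\<forall>\<^sub>F s in at_right (Sup S). Sup S < s"
      by (simp add: eventually_at_right_less)
    ultimately have "\<forall>\<^sub>F s in at_right (Sup S). g s \<le> g (Sup S) + e * (s - Sup S) \<and> s < b \<and> Sup S < s"
      using dini[OF lt \<open>0 < e\<close>] by eventually_elim auto
    then obtain s where s: "g s \<le> g (Sup S) + e * (s - Sup S)" "s < b" "Sup S < s"
      using eventually_happens'[OF trivial_limit_at_right_real] by blast
    then have "s \<in> S" using c lt by (auto simp: S_def algebra_simps)
    then show False using cSup_upper[OF _ bdd] s(3) by force
  qed
  then have "g b \<le> g a + e * (b - a)" using c by (auto simp: S_def)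
  also have "e * (b - a) \<le> e'"
    using \<open>0 < e'\<close> \<open>a \<le> b\<close> by (simp add: e_def field_simps)
  finally show "g b \<le> g a + e'" by simp
qed

text \<open>Only the upper right Dini derivative of \<open>\<rho>\<close> is controlled: in the applications \<open>\<rho>\<close> is the norm of
a curve, which need not be differentiable where the curve vanishes or where it is driven by a merely
measurable input. The difference \<open>\<rho> - m\<close>, weighted by the integrating factor, has nonpositive Dini
derivative.\<close>

lemma dini_comparison:
  fixes \<rho> m b :: "real \<Rightarrow> real"
  assumes "0 \<le> T" "continuous_on {0..T} \<rho>" "continuous_on {0..T} m"
    and m: "\<And>t. 0 \<le> t \<Longrightarrow> t < T \<Longrightarrow> (m has_real_derivative a * m t + b t) (at_right t)"
    and dini: "\<And>t e. 0 \<le> t \<Longrightarrow> t < T \<Longrightarrow> 0 < e \<Longrightarrow>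
      \<forall>\<^sub>F s in at_right t. \<rho> s \<le> \<rho> t + (s - t) * (a * \<rho> t + b t + e)"
    and "\<rho> 0 \<le> m 0"
  shows "\<rho> T \<le> m T"
proof -
  define g where "g s = exp (- a * s) * (\<rho> s - m s)" for s
  have "g T \<le> g 0"
  proof (rule nonincreasing_if_dini_nonpos[where g = g])
    show "continuous_on {0..T} g"
      unfolding g_def using assms(2,3) by (intro continuous_intros)
    fix t e' :: real assume t: "0 \<le> t" "t < T" and "0 < e'"
    define M where "M = exp (\<bar>a\<bar> * (t + 1))"
    have "0 < M" by (simp add: M_def)
    define e where "e = e' / (3 * M)"
    have "0 < e" using \<open>0 < e'\<close> \<open>0 < M\<close> by (simp add: e_def)
    \<comment> \<open>By the choice of the integrating factor, \<open>q\<close> has derivative \<open>0\<close> at \<open>t\<close>.\<close>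
    define q where "q s = exp (- a * s) * (1 + a * (s - t)) * (\<rho> t - m t)" for s
    have "(q has_real_derivative 0) (at_right t)"
      unfolding q_def by (auto intro!: derivative_eq_intros simp: algebra_simps)
    then have "\<forall>\<^sub>F s in at_right t. norm (q s - q t - (s - t) *\<^sub>R 0) \<le> (e' / 3) * \<bar>s - t\<bar>"
      using \<open>0 < e'\<close>
      by (intro vector_derivative_linearization) (auto simp: has_real_derivative_iff_has_vector_derivative)
    moreover have "\<forall>\<^sub>F s in at_right t. norm (m s - m t - (s - t) *\<^sub>R (a * m t + b t)) \<le> e * \<bar>s - t\<bar>"
      using m[OF t] \<open>0 < e\<close>
      by (intro vector_derivative_linearization) (auto simp: has_real_derivative_iff_has_vector_derivative)
    moreover have "\<forall>\<^sub>F s in at_right t. s < t + 1"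
      by (simp add: eventually_at_right_field) (use less_add_one in blast)
    moreover have "\<forall>\<^sub>F s in at_right t. t < s"
      by (simp add: eventually_at_right_less)
    ultimately show "\<forall>\<^sub>F s in at_right t. g s \<le> g t + e' * (s - t)"
      using dini[OF t \<open>0 < e\<close>]
    proof eventually_elim
      case (elim s)
      have "\<rho> s - m s \<le> (1 + a * (s - t)) * (\<rho> t - m t) + 2 * e * (s - t)"
        using elim by (simp add: algebra_simps abs_le_iff)
      then have "g s \<le> exp (- a * s) * ((1 + a * (s - t)) * (\<rho> t - m t) + 2 * e * (s - t))"
        unfolding g_def by (intro mult_left_mono) auto
      also have "\<dots> = q s + exp (- a * s) * (2 * e * (s - t))"
        by (simp add: q_def algebra_simps)
      also have "exp (- a * s) * (2 * e * (s - t)) \<le> M * (2 * e * (s - t))"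
      proof (rule mult_right_mono)
        have "- a * s \<le> \<bar>a\<bar> * s" using t elim by (intro mult_right_mono) auto
        also have "\<dots> \<le> \<bar>a\<bar> * (t + 1)" using elim by (intro mult_left_mono) auto
        finally show "exp (- a * s) \<le> M" by (simp add: M_def)
        show "0 \<le> 2 * e * (s - t)" using \<open>0 < e\<close> elim by simp
      qed
      also have "M * (2 * e * (s - t)) = (2 * e' / 3) * (s - t)"
        using \<open>0 < M\<close> by (simp add: e_def)
      also have "q s \<le> q t + (e' / 3) * (s - t)"
        using elim(1,4) abs_ge_self[of "q s - q t"] by simp
      also have "q t = g t" by (simp add: q_def g_def)
      finally have "g s \<le> g t + (e' / 3 * (s - t) + (2 * e' / 3) * (s - t))" by simp
      also have "e' / 3 * (s - t) + (2 * e' / 3) * (s - t) = e' * (s - t)" by (simp add: field_simps)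
      finally show ?case .
    qed
  qed fact
  also have "g 0 \<le> 0" using \<open>\<rho> 0 \<le> m 0\<close> by (simp add: g_def)
  finally show ?thesis by (simp add: g_def mult_le_0_iff)
qed

text \<open>An explicit Euler step: to first order in \<open>h\<close>, the norm grows by the factor \<open>1 + a h\<close> given by the
logarithmic norm \<open>a\<close>, and not by \<open>1 + L h\<close>. This is what makes negative \<open>a\<close> visible in the estimates.\<close>

lemma norm_add_scaled_le:
  fixes z F :: "'a::real_inner"
  assumes "z \<bullet> F \<le> a * (norm z)\<^sup>2" "norm F \<le> L * norm z" "0 \<le> h"
  shows "norm (z + h *\<^sub>R F) \<le> norm z * (1 + a * h + L\<^sup>2 * h\<^sup>2 / 2)"
proof (cases "z = 0")
  case True
  then show ?thesis using assms(2) by simp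
next
  case False
  define x where "x = 2 * a * h + L\<^sup>2 * h\<^sup>2"
  have "(norm F)\<^sup>2 \<le> (L * norm z)\<^sup>2" by (rule power_mono) (use assms in auto)
  then have "h\<^sup>2 * (norm F)\<^sup>2 \<le> h\<^sup>2 * (L * norm z)\<^sup>2" by (rule mult_left_mono) simp
  moreover have "2 * h * (z \<bullet> F) \<le> 2 * h * (a * (norm z)\<^sup>2)"
    using assms by (intro mult_left_mono) auto
  moreover have "(norm (z + h *\<^sub>R F))\<^sup>2 = (norm z)\<^sup>2 + 2 * h * (z \<bullet> F) + h\<^sup>2 * (norm F)\<^sup>2"
    by (simp only: power2_norm_eq_inner)
      (simp add: inner_add_left inner_add_right inner_commute power2_eq_square algebra_simps)
  ultimately have sq: "(norm (z + h *\<^sub>R F))\<^sup>2 \<le> (norm z)\<^sup>2 * (1 + x)"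
    by (simp add: x_def algebra_simps power_mult_distrib)
  have "0 \<le> (norm z)\<^sup>2 * (1 + x)" using sq by (rule order_trans[rotated]) simp
  then have "0 \<le> 1 + x" using False by (simp add: zero_le_mult_iff)
  have "1 + x \<le> (1 + x / 2)\<^sup>2" by (simp add: power2_eq_square algebra_simps)
  then have "(norm z)\<^sup>2 * (1 + x) \<le> (norm z * (1 + x / 2))\<^sup>2"
    unfolding power_mult_distrib by (rule mult_left_mono) simp
  with sq have "(norm (z + h *\<^sub>R F))\<^sup>2 \<le> (norm z * (1 + x / 2))\<^sup>2" by simp
  then have "norm (z + h *\<^sub>R F) \<le> norm z * (1 + x / 2)"
    by (rule power2_le_imp_le) (use \<open>0 \<le> 1 + x\<close> in auto)
  also have "1 + x / 2 = 1 + a * h + L\<^sup>2 * h\<^sup>2 / 2" by (simp add: x_def)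
  finally show ?thesis .
qed

text \<open>The splitting \<open>z = y + w\<close> into a differentiable part and a Lipschitz part covers differences of
controlled trajectories, where \<open>w\<close> is the integral of the input and has no pointwise derivative.\<close>

lemma logarithmic_norm_growth:
  fixes z y w F G :: "real \<Rightarrow> 'a::real_inner"
  assumes "0 \<le> T" and z: "continuous_on {0..T} z" and cm: "continuous_on {0..T} m"
    and y: "\<And>t. 0 \<le> t \<Longrightarrow> t < T \<Longrightarrow> (y has_vector_derivative F t + G t) (at_right t)"
    and zyw: "\<And>t. 0 \<le> t \<Longrightarrow> t \<le> T \<Longrightarrow> z t = y t + w t"
    and w: "\<And>s t. 0 \<le> t \<Longrightarrow> t \<le> s \<Longrightarrow> s \<le> T \<Longrightarrow> norm (w s - w t) \<le> \<beta> * (s - t)"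
    and F: "\<And>t. 0 \<le> t \<Longrightarrow> t < T \<Longrightarrow> z t \<bullet> F t \<le> a * (norm (z t))\<^sup>2"
      "\<And>t. 0 \<le> t \<Longrightarrow> t < T \<Longrightarrow> norm (F t) \<le> L * norm (z t)"
    and G: "\<And>t. 0 \<le> t \<Longrightarrow> t < T \<Longrightarrow> norm (G t) + \<beta> \<le> b t"
    and m: "\<And>t. 0 \<le> t \<Longrightarrow> t < T \<Longrightarrow> (m has_real_derivative a * m t + b t) (at_right t)"
    and "norm (z 0) \<le> m 0"
  shows "norm (z T) \<le> m T"
proof (rule dini_comparison[where \<rho> = "\<lambda>t. norm (z t)" and m = m and a = a and b = b])
  show "continuous_on {0..T} (\<lambda>t. norm (z t))" using z by (intro continuous_intros)
  fix t e :: real assume t: "0 \<le> t" "t < T" and "0 < e"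
  \<comment> \<open>Below step size \<open>d\<close>, the quadratic term of the Euler step costs at most \<open>e / 2\<close> per unit of time.\<close>
  define d where "d = e / (norm (z t) * L\<^sup>2 + 1)"
  have pos: "0 < norm (z t) * L\<^sup>2 + 1" by (rule add_nonneg_pos) auto
  then have "0 < d" using \<open>0 < e\<close> by (simp add: d_def)
  have "\<forall>\<^sub>F s in at_right t. norm (y s - y t - (s - t) *\<^sub>R (F t + G t)) \<le> e / 2 * \<bar>s - t\<bar>"
    using y[OF t] \<open>0 < e\<close> by (intro vector_derivative_linearization) auto
  moreover have "\<forall>\<^sub>F s in at_right t. s < min T (t + d)"
    by (simp add: eventually_at_right_field)
      (use t \<open>0 < d\<close> in \<open>auto intro!: exI[of _ "min T (t + d)"]\<close>)
  moreover have "\<forall>\<^sub>F s in at_right t. t < s"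
    by (simp add: eventually_at_right_less)
  ultimately show "\<forall>\<^sub>F s in at_right t. norm (z s) \<le> norm (z t) + (s - t) * (a * norm (z t) + b t + e)"
  proof eventually_elim
    case (elim s)
    define h where "h = s - t"
    have h: "0 < h" "h < d" using elim by (auto simp: h_def)
    define R where "R = y s - y t - h *\<^sub>R (F t + G t)"
    have "z s = (z t + h *\<^sub>R F t) + (h *\<^sub>R G t + (R + (w s - w t)))"
      using zyw[of s] zyw[of t] t elim by (simp add: R_def scaleR_add_right)
    then have "norm (z s) \<le> norm (z t + h *\<^sub>R F t) + norm (h *\<^sub>R G t + (R + (w s - w t)))"
      by (metis norm_triangle_ineq)
    also have "norm (h *\<^sub>R G t + (R + (w s - w t))) \<le> norm (h *\<^sub>R G t) + (norm R + norm (w s - w t))"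
      by (meson norm_triangle_ineq norm_triangle_le add_left_mono order_trans)
    also have "norm (h *\<^sub>R G t) = h * norm (G t)" using h by simp
    also have "norm R \<le> e / 2 * h" using elim h by (simp add: R_def h_def)
    also have "norm (w s - w t) \<le> \<beta> * h" using w[of t s] t elim by (simp add: h_def)
    also have "norm (z t + h *\<^sub>R F t) \<le> norm (z t) * (1 + a * h + L\<^sup>2 * h\<^sup>2 / 2)"
      using F[OF t] h by (intro norm_add_scaled_le) auto
    also have "\<dots> = norm (z t) + h * a * norm (z t) + h * (norm (z t) * L\<^sup>2 * h) / 2"
      by (simp add: algebra_simps power2_eq_square)
    also have "norm (z t) * L\<^sup>2 * h \<le> e"
    proof -
      have "norm (z t) * L\<^sup>2 * h \<le> (norm (z t) * L\<^sup>2 + 1) * d"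
        using h by (intro mult_mono) auto
      also have "\<dots> = e" using pos by (simp add: d_def)
      finally show ?thesis .
    qed
    finally have "norm (z s) \<le> norm (z t) + h * a * norm (z t) + h * e / 2
        + (h * norm (G t) + (e / 2 * h + \<beta> * h))" using h by simp
    also have "\<dots> = norm (z t) + h * (a * norm (z t) + (norm (G t) + \<beta>) + e)"
      by (simp add: algebra_simps)
    also have "\<dots> \<le> norm (z t) + h * (a * norm (z t) + b t + e)"
      using G[OF t] h by (intro add_left_mono mult_left_mono) auto
    finally show ?case by (simp add: h_def)
  qed
qed (use assms in auto)

section \<open>The growth function of scalar linear equations\<close>

text \<open>The integral of \<open>exp (a * s)\<close> over \<open>[0, t]\<close>, equivalently the solution of \<open>m' = a m + 1\<close> with
\<open>m 0 = 0\<close>. It treats the cases \<open>\<Gamma> = 0\<close> and \<open>\<Gamma> \<noteq> 0\<close> together.\<close>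

definition expint :: "real \<Rightarrow> real \<Rightarrow> real" where
  "expint a t = (if a = 0 then t else (exp (a * t) - 1) / a)"

lemma expint_0 [simp]: "expint a 0 = 0"
  by (simp add: expint_def)

lemma expint_has_real_derivative [derivative_intros]:
  "(expint a has_real_derivative exp (a * t)) (at t within S)"
proof (cases "a = 0")
  case True
  then have "expint a = (\<lambda>t. t)" by (auto simp: expint_def)
  then show ?thesis using True by simp
next
  case False
  then have "expint a = (\<lambda>t. (exp (a * t) - 1) / a)" by (auto simp: expint_def)
  then show ?thesis using False by (auto intro!: derivative_eq_intros)
qed

lemma exp_eq_expint: "exp (a * t) = 1 + a * expint a t"
  by (simp add: expint_def)

lemma continuous_on_expint [continuous_intros]: "continuous_on S (expint a)"
  by (meson DERIV_continuous_on expint_has_real_derivative)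

lemma expint_nonneg: "0 \<le> t \<Longrightarrow> 0 \<le> expint a t"
  by (cases "a > 0") (auto simp: expint_def divide_nonpos_neg mult_nonpos_nonneg zero_le_divide_iff)

lemma expint_mono:
  assumes "a \<le> b" "0 \<le> t"
  shows "expint a t \<le> expint b t"
proof -
  have "expint b 0 - expint a 0 \<le> expint b t - expint a t"
  proof (rule DERIV_nonneg_imp_nondecreasing[OF \<open>0 \<le> t\<close>])
    fix x assume "0 \<le> x" "x \<le> t"
    then have "exp (a * x) \<le> exp (b * x)" using \<open>a \<le> b\<close> by (simp add: mult_right_mono)
    then show "\<exists>y. ((\<lambda>s. expint b s - expint a s) has_real_derivative y) (at x) \<and> 0 \<le> y"
      by (intro exI[of _ "exp (b * x) - exp (a * x)"]) (auto intro!: derivative_eq_intros)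
  qed
  then show ?thesis by simp
qed

section \<open>Global existence for Lipschitz equations\<close>

text \<open>The signed integral from \<open>0\<close> to \<open>t\<close>: for each sign of \<open>t\<close> one of the two intervals is empty.\<close>

definition primitive :: "(real \<Rightarrow> 'a::banach) \<Rightarrow> real \<Rightarrow> 'a" where
  "primitive h t = integral {0..t} h - integral {t..0} h"

lemma primitive_0 [simp]: "primitive h 0 = 0"
  by (simp add: primitive_def)

text \<open>Near \<open>t\<close>, the primitive differs by a constant from an integral with a fixed left end point.\<close>

lemma primitive_has_vector_derivative:
  fixes h :: "real \<Rightarrow> 'a::euclidean_space"
  assumes h: "continuous_on UNIV h"
  shows "(primitive h has_vector_derivative h t) (at t)"
proof -
  define R where "R = \<bar>t\<bar> + 1"
  have int: "h integrable_on {p..q}" for p q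
    using h by (intro integrable_continuous_interval) (rule continuous_on_subset, auto)
  have eq: "integral {-R..s} h - integral {-R..0} h = primitive h s" if "s \<in> {-R<..<R}" for s
  proof (cases "0 \<le> s")
    case True
    moreover have "integral {s..0} h = 0" using True by (cases "s = 0") auto
    ultimately show ?thesis
      using Henstock_Kurzweil_Integration.integral_combine[of "-R" 0 s h] int that
      by (simp add: primitive_def R_def algebra_simps)
  next
    case False
    then show ?thesis
      using Henstock_Kurzweil_Integration.integral_combine[of "-R" s 0 h] int that
      by (simp add: primitive_def R_def algebra_simps)
  qed
  have "((\<lambda>s. integral {-R..s} h) has_vector_derivative h t) (at t within {-R..R})"
    by (rule integral_has_vector_derivative) (auto intro: continuous_on_subset[OF h] simp: R_def)
  then have "((\<lambda>s. integral {-R..s} h) has_vector_derivative h t) (at t within {-R<..<R})"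
    by (rule has_vector_derivative_within_subset) auto
  then have "((\<lambda>s. integral {-R..s} h) has_vector_derivative h t) (at t)"
    using at_within_open[of t "{-R<..<R}"] by (simp add: R_def abs_if split: if_splits)
  then have "((\<lambda>s. integral {-R..s} h - integral {-R..0} h) has_vector_derivative h t) (at t)"
    by (auto intro!: derivative_eq_intros)
  then show ?thesis
    by (rule has_vector_derivative_transform_within_open[of _ _ _ "{-R<..<R}"])
      (use eq in \<open>auto simp: R_def\<close>)
qed

lemma norm_primitive_le:
  fixes h :: "real \<Rightarrow> 'a::euclidean_space"
  assumes h: "continuous_on UNIV h" and "0 < c" "0 \<le> C" and bound: "\<And>s. norm (h s) \<le> C * exp (c * \<bar>s\<bar>)"
  shows "norm (primitive h t) \<le> C / c * exp (c * \<bar>t\<bar>)"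
proof -
  have int: "h integrable_on {p..q}" for p q
    using h by (intro integrable_continuous_interval) (rule continuous_on_subset, auto)
  show ?thesis
  proof (cases "0 \<le> t")
    case True
    have "((\<lambda>s. C * exp (c * s)) has_integral C / c * exp (c * t) - C / c * exp (c * 0)) {0..t}"
      using True \<open>0 < c\<close>
      by (intro fundamental_theorem_of_calculus)
        (auto intro!: derivative_eq_intros simp: has_real_derivative_iff_has_vector_derivative[symmetric])
    moreover have "primitive h t = integral {0..t} h"
      using True by (cases "t = 0") (auto simp: primitive_def)
    moreover have "norm (integral {0..t} h) \<le> integral {0..t} (\<lambda>s. C * exp (c * s))"
      using bound calculation(1) int
      by (intro integral_norm_bound_integral) (auto simp: has_integral_integrable_integral, metis abs_of_nonneg)
    ultimately show ?thesis using True \<open>0 < c\<close> \<open>0 \<le> C\<close>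
      by (simp add: has_integral_integrable_integral) (smt (verit) divide_nonneg_pos)
  next
    case False
    have "((\<lambda>s. C * exp (- (c * s))) has_integral - C / c * exp (- (c * 0)) - - C / c * exp (- (c * t))) {t..0}"
      using False \<open>0 < c\<close>
      by (intro fundamental_theorem_of_calculus)
        (auto intro!: derivative_eq_intros simp: has_real_derivative_iff_has_vector_derivative[symmetric])
    moreover have "primitive h t = - integral {t..0} h"
      using False by (auto simp: primitive_def)
    moreover have "norm (integral {t..0} h) \<le> integral {t..0} (\<lambda>s. C * exp (- (c * s)))"
      using bound calculation(1) int
      by (intro integral_norm_bound_integral)
        (auto simp: has_integral_integrable_integral, metis abs_of_nonpos mult_minus_right)
    ultimately show ?thesis using False \<open>0 < c\<close> \<open>0 \<le> C\<close>
      by (simp add: has_integral_integrable_integral) (smt (verit) divide_nonneg_pos)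
  qed
qed

text \<open>Writing \<open>x t = x0 + exp (c * \<bar>t\<bar>) *\<^sub>R g t\<close> with \<open>c = \<bar>L\<bar> + 1\<close> turns the integral equation into a
fixed point equation for a bounded continuous \<open>g\<close> on the whole line. The weight makes the Picard
operator a contraction with factor \<open>\<bar>L\<bar> / c < 1\<close>, so no local solutions have to be glued.\<close>

lemma picard_global:
  fixes f :: "real \<Rightarrow> 'a::euclidean_space \<Rightarrow> 'a"
  assumes cont: "\<And>x. continuous_on UNIV x \<Longrightarrow> continuous_on UNIV (\<lambda>t. f t (x t))"
    and lip: "\<And>t x y. norm (f t x - f t y) \<le> L * norm (x - y)"
    and bound: "\<And>t. norm (f t 0) \<le> M"
  shows "\<exists>x. x 0 = x0 \<and> (\<forall>t. (x has_vector_derivative f t (x t)) (at t))"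
proof -
  define c where "c = \<bar>L\<bar> + 1"
  have "0 < c" by (simp add: c_def)
  have lip': "norm (f t x - f t y) \<le> \<bar>L\<bar> * norm (x - y)" for t x y
    by (rule order_trans[OF lip]) (simp add: mult_right_mono)
  have "0 \<le> M" using bound[of 0] by (rule order_trans[rotated]) simp
  define X where "X g t = x0 + exp (c * \<bar>t\<bar>) *\<^sub>R g t" for g :: "real \<Rightarrow> 'a" and t
  define Q where "Q g t = exp (- (c * \<bar>t\<bar>)) *\<^sub>R primitive (\<lambda>s. f s (X g s)) t" for g t
  have contf: "continuous_on UNIV (\<lambda>s. f s (X g s))" if "continuous_on UNIV g" for g
    unfolding X_def by (intro cont continuous_intros that)
  have contp: "continuous_on UNIV (primitive h)" if "continuous_on UNIV h" for h :: "real \<Rightarrow> 'a"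
    using primitive_has_vector_derivative[OF that]
    by (meson continuous_at_imp_continuous_on has_vector_derivative_continuous)
  have Q: "Q (apply_bcontfun g) \<in> bcontfun" for g
  proof (rule bcontfun_normI)
    have g: "continuous_on UNIV (apply_bcontfun g)" by simp
    show "continuous_on UNIV (Q g)"
      unfolding Q_def by (intro continuous_intros contp contf g)
    fix t
    define C where "C = M + \<bar>L\<bar> * norm x0 + \<bar>L\<bar> * norm g"
    have "norm (f s (X g s)) \<le> C * exp (c * \<bar>s\<bar>)" for s
    proof -
      have 1: "1 \<le> exp (c * \<bar>s\<bar>)" using \<open>0 < c\<close> by simp
      have "norm (X g s) \<le> norm x0 + exp (c * \<bar>s\<bar>) * norm g"
        unfolding X_def by (rule norm_triangle_le) (simp add: norm_bounded mult_left_mono)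
      then have "norm (f s (X g s)) \<le> M + \<bar>L\<bar> * (norm x0 + exp (c * \<bar>s\<bar>) * norm g)"
        using bound[of s] lip'[of s "X g s" 0] norm_triangle_sub[of "f s (X g s)" "f s 0"]
        by (smt (verit) diff_zero mult_left_mono abs_ge_zero)
      also have "\<dots> \<le> M * exp (c * \<bar>s\<bar>) + \<bar>L\<bar> * (norm x0 * exp (c * \<bar>s\<bar>) + exp (c * \<bar>s\<bar>) * norm g)"
        using 1 \<open>0 \<le> M\<close> by (intro add_mono mult_left_mono order_refl) (auto simp: mult_le_cancel_left1)
      finally show ?thesis by (simp add: C_def algebra_simps)
    qed
    moreover have "0 \<le> C" using \<open>0 \<le> M\<close> by (simp add: C_def)
    ultimately have "norm (primitive (\<lambda>s. f s (X g s)) t) \<le> C / c * exp (c * \<bar>t\<bar>)"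
      using \<open>0 < c\<close> by (intro norm_primitive_le contf g) auto
    then have "exp (- (c * \<bar>t\<bar>)) * norm (primitive (\<lambda>s. f s (X g s)) t) \<le> exp (- (c * \<bar>t\<bar>)) * (C / c * exp (c * \<bar>t\<bar>))"
      by (rule mult_left_mono) simp
    also have "\<dots> = C / c" by (simp add: exp_minus)
    finally show "norm (Q g t) \<le> C / c" by (simp add: Q_def)
  qed
  define P where "P g = Bcontfun (Q (apply_bcontfun g))" for g
  have P: "apply_bcontfun (P g) = Q (apply_bcontfun g)" for g
    using Q by (simp add: P_def Bcontfun_inverse)
  have "\<exists>!g. P g = g"
  proof (rule banach_fix_type)
    show "0 \<le> \<bar>L\<bar> / c" "\<bar>L\<bar> / c < 1" by (auto simp: c_def)
    show "\<forall>g h. dist (P g) (P h) \<le> \<bar>L\<bar> / c * dist g h"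
    proof (intro allI dist_bound)
      fix g h :: "real \<Rightarrow>\<^sub>C 'a" and t
      have gh: "continuous_on UNIV (apply_bcontfun g)" "continuous_on UNIV (apply_bcontfun h)" by simp_all
      let ?d = "\<lambda>s. f s (X g s) - f s (X h s)"
      have diff: "primitive (\<lambda>s. f s (X g s)) t - primitive (\<lambda>s. f s (X h s)) t = primitive ?d t"
      proof -
        have "(\<lambda>s. f s (X k s)) integrable_on {p..q}" if "k = g \<or> k = h" for k :: "real \<Rightarrow>\<^sub>C 'a" and p q
          using contf gh that by (intro integrable_continuous_interval) (metis continuous_on_subset subset_UNIV)
        then show ?thesis by (simp add: primitive_def Henstock_Kurzweil_Integration.integral_diff)
      qed
      have "norm (?d s) \<le> (\<bar>L\<bar> * dist g h) * exp (c * \<bar>s\<bar>)" for s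
      proof -
        have "X g s - X h s = exp (c * \<bar>s\<bar>) *\<^sub>R (g s - h s)" by (simp add: X_def scaleR_diff_right)
        then have "norm (?d s) \<le> \<bar>L\<bar> * (exp (c * \<bar>s\<bar>) * norm (g s - h s))"
          using lip'[of s "X g s" "X h s"] by simp
        also have "\<dots> \<le> \<bar>L\<bar> * (exp (c * \<bar>s\<bar>) * dist g h)"
          using dist_bounded[of g s h] by (intro mult_left_mono) (auto simp: dist_norm)
        finally show ?thesis by (simp add: algebra_simps)
      qed
      then have "norm (primitive ?d t) \<le> (\<bar>L\<bar> * dist g h) / c * exp (c * \<bar>t\<bar>)"
        using \<open>0 < c\<close> gh by (intro norm_primitive_le continuous_intros contf) auto
      then have "exp (- (c * \<bar>t\<bar>)) * norm (primitive ?d t) \<le> exp (- (c * \<bar>t\<bar>)) * ((\<bar>L\<bar> * dist g h) / c * exp (c * \<bar>t\<bar>))"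
        by (rule mult_left_mono) simp
      also have "\<dots> = \<bar>L\<bar> / c * dist g h" by (simp add: exp_minus)
      finally show "dist (P g t) (P h t) \<le> \<bar>L\<bar> / c * dist g h"
        by (simp add: P Q_def dist_norm scaleR_diff_right[symmetric] diff)
    qed
  qed
  then obtain g where "P g = g" by blast
  then have g: "apply_bcontfun g t = Q g t" for t using P by metis
  define x where "x t = x0 + primitive (\<lambda>s. f s (X g s)) t" for t
  have x: "x t = X g t" for t
    by (subst X_def, subst g) (simp add: x_def Q_def exp_minus)
  have "(x has_vector_derivative f t (x t)) (at t)" for t
  proof -
    have "((\<lambda>t. x0 + primitive (\<lambda>s. f s (X g s)) t) has_vector_derivative f t (X g t)) (at t)"
      by (auto intro!: derivative_eq_intros primitive_has_vector_derivative contf)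
    then show ?thesis by (simp add: x_def[abs_def, symmetric] x)
  qed
  moreover have "x 0 = x0" by (simp add: x_def)
  ultimately show ?thesis by blast
qed

section \<open>Differentiable flows and their variational equation\<close>

lemma curve_norm_growth:
  fixes z F G :: "real \<Rightarrow> 'a::real_inner"
  assumes "0 \<le> T"
    and z: "\<And>t. 0 \<le> t \<Longrightarrow> (z has_vector_derivative F t + G t) (at t)"
    and F: "\<And>t. 0 \<le> t \<Longrightarrow> z t \<bullet> F t \<le> a * (norm (z t))\<^sup>2"
      "\<And>t. 0 \<le> t \<Longrightarrow> norm (F t) \<le> L * norm (z t)"
    and G: "\<And>t. 0 \<le> t \<Longrightarrow> norm (G t) \<le> b t"
    and m: "\<And>t. 0 \<le> t \<Longrightarrow> (m has_real_derivative a * m t + b t) (at t)"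
    and "norm (z 0) \<le> m 0"
  shows "norm (z T) \<le> m T"
proof (rule logarithmic_norm_growth[where z = z and y = z and w = "\<lambda>_. 0" and \<beta> = 0 and F = F and G = G and m = m
      and a = a and b = b and L = L])
  show "continuous_on {0..T} z"
    using z by (meson atLeastAtMost_iff continuous_at_imp_continuous_on has_vector_derivative_continuous)
  show "continuous_on {0..T} m"
    using m by (meson atLeastAtMost_iff continuous_at_imp_continuous_on DERIV_continuous)
  show "(z has_vector_derivative F t + G t) (at_right t)" if "0 \<le> t" for t
    using z[OF that] by (rule has_vector_derivative_at_within)
  show "(m has_real_derivative a * m t + b t) (at_right t)" if "0 \<le> t" for t
    using m[OF that] by (rule has_field_derivative_at_within)
qed (use assms in auto)

text \<open>The constant \<open>a\<close> bounds the logarithmic norm of the derivative and governs forward growth; \<open>L\<close> bounds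
its norm; \<open>K\<close> stands for a bound on the second derivative.\<close>

locale smooth_field =
  fixes N :: "'a::euclidean_space \<Rightarrow> 'a" and N' :: "'a \<Rightarrow> 'a \<Rightarrow> 'a" and a L K :: real
  assumes deriv: "(N has_derivative N' x) (at x)"
    and log_norm: "h \<bullet> N' x h \<le> a * (norm h)\<^sup>2"
    and norm_deriv: "norm (N' x h) \<le> L * norm h"
    and deriv_lip: "norm (N' x h - N' y h) \<le> K * norm (x - y) * norm h"
begin

lemma linear_deriv: "linear (N' x)"
  using deriv by (rule has_derivative_linear)

lemmas deriv_simps = linear_add[OF linear_deriv] linear_diff[OF linear_deriv]
  linear_scale[OF linear_deriv] linear_0[OF linear_deriv]

lemma L_nonneg: "0 \<le> L"
proof -
  obtain b :: 'a where "b \<in> Basis" using nonempty_Basis by blast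
  then show ?thesis using order_trans[OF norm_ge_zero norm_deriv[of undefined b]] by simp
qed

lemma K_nonneg: "0 \<le> K"
proof -
  obtain b :: 'a where "b \<in> Basis" using nonempty_Basis by blast
  then show ?thesis using order_trans[OF norm_ge_zero deriv_lip[of b b 0]] by simp
qed

lemma field_lip: "norm (N x - N y) \<le> L * norm (x - y)"
proof (rule differentiable_bound[where S = UNIV])
  fix x show "(N has_derivative N' x) (at x within UNIV)" using deriv by simp
  show "onorm (N' x) \<le> L"
    using norm_deriv L_nonneg by (intro onorm_bound)
qed auto

text \<open>The mean value theorem for \<open>s \<mapsto> (x - y) \<bullet> N (y + s *\<^sub>R (x - y))\<close>; taking the inner product first keeps
the one-sided constant \<open>a\<close>.\<close>

lemma field_one_sided_lip: "(x - y) \<bullet> (N x - N y) \<le> a * (norm (x - y))\<^sup>2"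
proof -
  define f where "f s = (x - y) \<bullet> N (y + s *\<^sub>R (x - y))" for s
  have f: "(f has_real_derivative (x - y) \<bullet> N' (y + s *\<^sub>R (x - y)) (x - y)) (at s)" for s
  proof -
    have "((\<lambda>s. y + s *\<^sub>R (x - y)) has_vector_derivative x - y) (at s)"
      by (auto intro!: derivative_eq_intros)
    then have "((\<lambda>s. N (y + s *\<^sub>R (x - y))) has_vector_derivative N' (y + s *\<^sub>R (x - y)) (x - y)) (at s)"
      using vector_derivative_diff_chain_within[of "\<lambda>s. y + s *\<^sub>R (x - y)" "x - y" s UNIV N]
      by (auto simp: o_def intro: has_derivative_at_withinI deriv)
    then show ?thesis
      unfolding f_def has_real_derivative_iff_has_vector_derivative
      by (rule bounded_linear.has_vector_derivative[OF bounded_linear_inner_right])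
  qed
  obtain s where "f 1 - f 0 = (x - y) \<bullet> N' (y + s *\<^sub>R (x - y)) (x - y)"
    using MVT2[of 0 1 f "\<lambda>s. (x - y) \<bullet> N' (y + s *\<^sub>R (x - y)) (x - y)"] f by auto
  then show ?thesis using log_norm by (simp add: f_def inner_diff_right)
qed

lemma field_remainder: "norm (N y - N x - N' x (y - x)) \<le> K * (norm (y - x))\<^sup>2"
proof -
  have "norm ((N y - N' x y) - (N x - N' x x)) \<le> (K * norm (y - x)) * norm (y - x)"
  proof (rule differentiable_bound[where S = "closed_segment x y"])
    fix z assume z: "z \<in> closed_segment x y"
    have "((\<lambda>w. N' x w) has_derivative N' x) (at z)"
      using linear_deriv by (rule linear_imp_has_derivative)
    then show "((\<lambda>w. N w - N' x w) has_derivative (\<lambda>h. N' z h - N' x h)) (at z within closed_segment x y)"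
      by (rule has_derivative_diff[OF has_derivative_at_withinI[OF deriv] has_derivative_at_withinI])
    show "onorm (\<lambda>h. N' z h - N' x h) \<le> K * norm (y - x)"
    proof (rule onorm_bound)
      show "0 \<le> K * norm (y - x)" using K_nonneg by simp
      fix h :: 'a
      have "norm (z - x) \<le> norm (y - x)"
        using segment_bound(1)[OF z] by (simp add: norm_minus_commute)
      then have "K * norm (z - x) * norm h \<le> K * norm (y - x) * norm h"
        using K_nonneg by (intro mult_right_mono mult_left_mono) auto
      then show "norm (N' z h - N' x h) \<le> K * norm (y - x) * norm h"
        using deriv_lip[of z h x] by linarith
    qed
  qed auto
  then show ?thesis by (simp add: deriv_simps power2_eq_square algebra_simps)
qed

lemma continuous_on_field [continuous_intros]:
  "continuous_on S p \<Longrightarrow> continuous_on S (\<lambda>t. N (p t))"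
  by (rule continuous_on_compose2[of UNIV N])
    (auto intro!: continuous_at_imp_continuous_on has_derivative_continuous[OF deriv])

lemma continuous_on_deriv [continuous_intros]:
  assumes "continuous_on S p" "continuous_on S z"
  shows "continuous_on S (\<lambda>t. N' (p t) (z t))"
  unfolding continuous_on_def
proof
  fix t assume t: "t \<in> S"
  have "((\<lambda>s. N' (p s) (z s) - N' (p t) (z t)) \<longlongrightarrow> 0) (at t within S)"
  proof (rule Lim_null_comparison)
    show "\<forall>\<^sub>F s in at t within S. norm (N' (p s) (z s) - N' (p t) (z t))
        \<le> K * norm (p s - p t) * norm (z s) + L * norm (z s - z t)"
    proof (intro always_eventually allI)
      fix s
      have "norm (N' (p s) (z s) - N' (p t) (z t))
          \<le> norm (N' (p s) (z s) - N' (p t) (z s)) + norm (N' (p t) (z s - z t))"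
        by (rule order_trans[OF _ norm_triangle_ineq]) (simp add: deriv_simps)
      then show "norm (N' (p s) (z s) - N' (p t) (z t))
          \<le> K * norm (p s - p t) * norm (z s) + L * norm (z s - z t)"
        using deriv_lip[of "p s" "z s" "p t"] norm_deriv[of "p t" "z s - z t"] by linarith
    qed
    have "((\<lambda>s. K * norm (p s - p t) * norm (z s) + L * norm (z s - z t)) \<longlongrightarrow>
        K * norm (p t - p t) * norm (z t) + L * norm (z t - z t)) (at t within S)"
      using assms t unfolding continuous_on_def by (intro tendsto_intros) auto
    then show "((\<lambda>s. K * norm (p s - p t) * norm (z s) + L * norm (z s - z t)) \<longlongrightarrow> 0) (at t within S)"
      by simp
  qed
  then show "((\<lambda>s. N' (p s) (z s)) \<longlongrightarrow> N' (p t) (z t)) (at t within S)"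
    by (rule Lim_null[THEN iffD2])
qed

text \<open>Reversing time loses the one-sided information on \<open>N\<close>, hence the constant \<open>L\<close> in place of \<open>a\<close>.\<close>

lemma reversed: "smooth_field (\<lambda>x. - N x) (\<lambda>x h. - N' x h) L L K"
proof
  fix x y h
  show "((\<lambda>x. - N x) has_derivative (\<lambda>h. - N' x h)) (at x)"
    by (intro has_derivative_minus deriv)
  have "h \<bullet> - N' x h \<le> norm h * norm (- N' x h)" by (rule norm_cauchy_schwarz)
  also have "\<dots> \<le> norm h * (L * norm h)" using norm_deriv by (intro mult_left_mono) auto
  finally show "h \<bullet> - N' x h \<le> L * (norm h)\<^sup>2" by (simp add: power2_eq_square mult_ac)
  show "norm (- N' x h) \<le> L * norm h" using norm_deriv by simp
  show "norm (- N' x h - - N' y h) \<le> K * norm (x - y) * norm h"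
    using deriv_lip[of x h y] by (simp add: norm_minus_commute)
qed

lemma integral_curves_dist:
  assumes "\<And>s. (z has_vector_derivative N (z s)) (at s)" "\<And>s. (y has_vector_derivative N (y s)) (at s)"
    and "0 \<le> t"
  shows "norm (z t - y t) \<le> exp (a * t) * norm (z 0 - y 0)"
proof (rule curve_norm_growth[where a = a and L = L and G = "\<lambda>_. 0" and z = "\<lambda>t. z t - y t" and F = "\<lambda>t. N (z t) - N (y t)"
      and m = "\<lambda>t. exp (a * t) * norm (z 0 - y 0)" and b = "\<lambda>_. 0"])
  show "((\<lambda>t. z t - y t) has_vector_derivative N (z s) - N (y s) + 0) (at s)" for s
    using assms by (auto intro!: derivative_eq_intros)
  show "((\<lambda>t. exp (a * t) * norm (z 0 - y 0)) has_real_derivative a * (exp (a * s) * norm (z 0 - y 0)) + 0) (at s)" for s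
    by (auto intro!: derivative_eq_intros)
qed (simp_all add: assms(3) field_one_sided_lip field_lip)

lemma integral_curve_reversed:
  assumes "\<And>s. (z has_vector_derivative N (z s)) (at s)"
  shows "((\<lambda>s. z (- s)) has_vector_derivative - N (z (- s))) (at s)"
proof -
  have "((\<lambda>s. - s) has_real_derivative -1) (at s)" by (auto intro!: derivative_eq_intros)
  then show ?thesis
    using vector_diff_chain_at[of uminus "-1" s z "N (z (- s))"] assms
    by (simp add: o_def has_real_derivative_iff_has_vector_derivative)
qed

lemma integral_curve_unique:
  assumes "\<And>s. (z has_vector_derivative N (z s)) (at s)" "\<And>s. (y has_vector_derivative N (y s)) (at s)"
    and "z 0 = y 0"
  shows "z t = y t"
proof (cases "0 \<le> t")
  case True
  then show ?thesis using integral_curves_dist[OF assms(1,2) True] assms(3) by simp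
next
  case False
  then show ?thesis
    using smooth_field.integral_curves_dist[OF reversed
        integral_curve_reversed[OF assms(1)] integral_curve_reversed[OF assms(2)], of "- t"] assms(3)
    by simp
qed

text \<open>This shows that the description in \<^const>\<open>flow\<close> determines a curve on the whole line.\<close>

lemma ex1_integral_curve: "\<exists>!z. z 0 = x \<and> (\<forall>s. (z has_vector_derivative N (z s)) (at s))"
proof (rule ex_ex1I)
  show "\<exists>z. z 0 = x \<and> (\<forall>s. (z has_vector_derivative N (z s)) (at s))"
    by (rule picard_global[where f = "\<lambda>_. N" and L = L and M = "norm (N 0)"])
      (auto intro!: continuous_intros field_lip)
next
  fix y z :: "real \<Rightarrow> 'a"
  assume *: "y 0 = x \<and> (\<forall>s. (y has_vector_derivative N (y s)) (at s))"
    "z 0 = x \<and> (\<forall>s. (z has_vector_derivative N (z s)) (at s))"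
  show "y = z"
  proof
    show "y t = z t" for t by (rule integral_curve_unique) (use * in simp_all)
  qed
qed

lemma flow_eqI:
  assumes "z 0 = x" "\<And>s. (z has_vector_derivative N (z s)) (at s)"
  shows "flow N t x = z t"
proof -
  have "(THE z. z 0 = x \<and> (\<forall>s. (z has_vector_derivative N (z s)) (at s))) = z"
    by (rule the1_equality[OF ex1_integral_curve]) (use assms in auto)
  then show ?thesis by (simp add: flow_def)
qed

lemma flow_0 [simp]: "flow N 0 x = x"
  and flow_has_vector_derivative: "((\<lambda>s. flow N s x) has_vector_derivative N (flow N t x)) (at t)"
proof -
  from ex1_implies_ex[OF ex1_integral_curve[of x]]
  obtain z where *: "z 0 = x \<and> (\<forall>s. (z has_vector_derivative N (z s)) (at s))" ..
  then have z: "z 0 = x" "(z has_vector_derivative N (z s)) (at s)" for s by auto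
  have eq: "flow N s x = z s" for s using z by (rule flow_eqI)
  show "flow N 0 x = x" using z(1) by (simp add: eq)
  show "((\<lambda>s. flow N s x) has_vector_derivative N (flow N t x)) (at t)"
    using z(2)[of t] by (simp add: eq)
qed

lemma continuous_on_flow: "continuous_on S (\<lambda>s. flow N s x)"
  by (intro continuous_at_imp_continuous_on ballI
      has_vector_derivative_continuous[OF flow_has_vector_derivative])

lemma flow_reversed: "flow (\<lambda>x. - N x) t x = flow N (- t) x"
  by (rule smooth_field.flow_eqI[OF reversed])
    (auto intro: integral_curve_reversed[OF flow_has_vector_derivative])

lemma flow_dist: "0 \<le> t \<Longrightarrow> norm (flow N t x - flow N t y) \<le> exp (a * t) * norm (x - y)"
  using integral_curves_dist[OF flow_has_vector_derivative[of x] flow_has_vector_derivative[of y]] by simp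

lemma linearized_growth:
  assumes "\<And>t. 0 \<le> t \<Longrightarrow> (z has_vector_derivative N' (p t) (z t)) (at t)" "0 \<le> t"
  shows "norm (z t) \<le> exp (a * t) * norm (z 0)"
proof (rule curve_norm_growth[where a = a and L = L and G = "\<lambda>_. 0" and z = z and F = "\<lambda>t. N' (p t) (z t)"
      and m = "\<lambda>t. exp (a * t) * norm (z 0)" and b = "\<lambda>_. 0"])
  show "((\<lambda>t. exp (a * t) * norm (z 0)) has_real_derivative a * (exp (a * s) * norm (z 0)) + 0) (at s)" for s
    by (auto intro!: derivative_eq_intros)
  show "(z has_vector_derivative N' (p t) (z t) + 0) (at t)" if "0 \<le> t" for t
    using assms(1)[OF that] by simp
qed (simp_all add: assms(2) log_norm norm_deriv)

text \<open>The right-hand side solves \<open>m' = a m + C e\<^sup>2\<^sup>a\<^sup>t\<close> with \<open>m 0 = 0\<close>. Forcings of size \<open>e\<^sup>2\<^sup>a\<^sup>t\<close> arise as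
products of two quantities that each grow like \<open>e\<^sup>a\<^sup>t\<close>.\<close>

lemma forced_linearized_growth:
  assumes z: "\<And>t. 0 \<le> t \<Longrightarrow> (z has_vector_derivative N' (p t) (z t) + G t) (at t)"
    and G: "\<And>t. 0 \<le> t \<Longrightarrow> norm (G t) \<le> C * (exp (a * t) * exp (a * t))"
    and "z 0 = 0" "0 \<le> t"
  shows "norm (z t) \<le> C * (exp (a * t) * expint a t)"
proof (rule curve_norm_growth[where a = a and L = L and G = G and z = z and F = "\<lambda>t. N' (p t) (z t)"
      and m = "\<lambda>t. C * (exp (a * t) * expint a t)" and b = "\<lambda>t. C * (exp (a * t) * exp (a * t))"])
  show "((\<lambda>t. C * (exp (a * t) * expint a t)) has_real_derivative
      a * (C * (exp (a * s) * expint a s)) + C * (exp (a * s) * exp (a * s))) (at s)" for s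
    by (auto intro!: derivative_eq_intros simp: algebra_simps)
qed (simp_all add: z G assms(3,4) log_norm norm_deriv)

text \<open>The solution of the linearisation along the orbit of \<open>x\<close> with initial value \<open>h\<close>; it turns out to be the
derivative of the flow in direction \<open>h\<close>.\<close>

definition variation :: "'a \<Rightarrow> 'a \<Rightarrow> real \<Rightarrow> 'a" where
  "variation x h = (SOME z. z 0 = h \<and>
     (\<forall>t. (z has_vector_derivative N' (flow N t x) (z t)) (at t)))"

lemma variation_0 [simp]: "variation x h 0 = h"
  and variation_has_vector_derivative:
    "(variation x h has_vector_derivative N' (flow N t x) (variation x h t)) (at t)"
proof -
  have "\<exists>z. z 0 = h \<and> (\<forall>t. (z has_vector_derivative N' (flow N t x) (z t)) (at t))"
  proof (rule picard_global[where f = "\<lambda>t. N' (flow N t x)" and L = L and M = 0])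
    show "norm (N' (flow N t x) v - N' (flow N t x) w) \<le> L * norm (v - w)" for t v w
      using norm_deriv[of "flow N t x" "v - w"] by (simp add: deriv_simps)
  qed (simp_all add: deriv_simps continuous_on_deriv continuous_on_flow)
  from someI_ex[OF this, folded variation_def]
  have v: "variation x h 0 = h \<and>
      (\<forall>t. (variation x h has_vector_derivative N' (flow N t x) (variation x h t)) (at t))" .
  show "variation x h 0 = h" using v by (rule conjunct1)
  show "(variation x h has_vector_derivative N' (flow N t x) (variation x h t)) (at t)"
    by (rule spec[OF conjunct2[OF v]])
qed

lemma continuous_on_variation: "continuous_on S (variation x h)"
  by (intro continuous_at_imp_continuous_on ballI
      has_vector_derivative_continuous[OF variation_has_vector_derivative])

lemma norm_variation_le: "0 \<le> t \<Longrightarrow> norm (variation x h t) \<le> exp (a * t) * norm h"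
  using linearized_growth[OF variation_has_vector_derivative[of x h]] by simp

text \<open>The defect of additivity or homogeneity solves the linearised equation with initial value \<open>0\<close>, hence
vanishes by the growth bound.\<close>

lemma linear_variation:
  assumes "0 \<le> t"
  shows "linear (\<lambda>h. variation x h t)"
proof (rule linearI)
  fix h k :: 'a and r :: real
  define z where "z s = variation x (h + k) s - (variation x h s + variation x k s)" for s
  have "(z has_vector_derivative N' (flow N s x) (z s)) (at s)" for s
    unfolding z_def[abs_def] deriv_simps
    by (intro has_vector_derivative_diff has_vector_derivative_add variation_has_vector_derivative)
  from linearized_growth[OF this assms] show "variation x (h + k) t = variation x h t + variation x k t"
    by (simp add: z_def)
  define y where "y s = variation x (r *\<^sub>R h) s - r *\<^sub>R variation x h s" for s
  have "(y has_vector_derivative N' (flow N s x) (y s)) (at s)" for s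
    unfolding y_def[abs_def] deriv_simps
    by (intro has_vector_derivative_diff
        bounded_linear.has_vector_derivative[OF bounded_linear_scaleR_right]
        variation_has_vector_derivative)
  from linearized_growth[OF this assms] show "variation x (r *\<^sub>R h) t = r *\<^sub>R variation x h t"
    by (simp add: y_def)
qed

text \<open>The difference of the two solutions satisfies the linearisation at \<open>x\<close>, forced by the difference of the
two linearisations applied to \<open>variation y h\<close>.\<close>

lemma variation_dist:
  assumes "0 \<le> t"
  shows "norm (variation x h t - variation y h t) \<le> K * norm (x - y) * norm h * (exp (a * t) * expint a t)"
proof (rule forced_linearized_growth[where p = "\<lambda>t. flow N t x"
      and z = "\<lambda>t. variation x h t - variation y h t"
      and G = "\<lambda>t. N' (flow N t x) (variation y h t) - N' (flow N t y) (variation y h t)"])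
  show "((\<lambda>t. variation x h t - variation y h t) has_vector_derivative
      N' (flow N t x) (variation x h t - variation y h t)
      + (N' (flow N t x) (variation y h t) - N' (flow N t y) (variation y h t))) (at t)" for t
  proof -
    have "((\<lambda>t. variation x h t - variation y h t) has_vector_derivative
        N' (flow N t x) (variation x h t) - N' (flow N t y) (variation y h t)) (at t)"
      by (intro has_vector_derivative_diff variation_has_vector_derivative)
    then show ?thesis by (simp add: deriv_simps)
  qed
  fix t :: real assume "0 \<le> t"
  have "norm (N' (flow N t x) (variation y h t) - N' (flow N t y) (variation y h t))
      \<le> K * norm (flow N t x - flow N t y) * norm (variation y h t)" by (rule deriv_lip)
  also have "\<dots> \<le> K * (exp (a * t) * norm (x - y)) * (exp (a * t) * norm h)"
    using K_nonneg \<open>0 \<le> t\<close>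
    by (intro mult_mono mult_left_mono flow_dist norm_variation_le) auto
  finally show "norm (N' (flow N t x) (variation y h t) - N' (flow N t y) (variation y h t))
      \<le> K * norm (x - y) * norm h * (exp (a * t) * exp (a * t))" by (simp add: mult_ac)
qed (use assms in auto)

text \<open>The remainder satisfies the linearisation at \<open>x\<close>, forced by the second-order Taylor remainder of \<open>N\<close> along
the two orbits, so it is quadratic in \<open>y - x\<close>.\<close>

lemma flow_remainder:
  assumes "0 \<le> t"
  shows "norm (flow N t y - flow N t x - variation x (y - x) t)
    \<le> K * (norm (y - x))\<^sup>2 * (exp (a * t) * expint a t)"
proof (rule forced_linearized_growth[where p = "\<lambda>t. flow N t x"
      and z = "\<lambda>t. flow N t y - flow N t x - variation x (y - x) t"
      and G = "\<lambda>t. N (flow N t y) - N (flow N t x) - N' (flow N t x) (flow N t y - flow N t x)"])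
  show "((\<lambda>t. flow N t y - flow N t x - variation x (y - x) t) has_vector_derivative
      N' (flow N t x) (flow N t y - flow N t x - variation x (y - x) t)
      + (N (flow N t y) - N (flow N t x) - N' (flow N t x) (flow N t y - flow N t x))) (at t)" for t
  proof -
    have "((\<lambda>t. flow N t y - flow N t x - variation x (y - x) t) has_vector_derivative
        N (flow N t y) - N (flow N t x) - N' (flow N t x) (variation x (y - x) t)) (at t)"
      by (intro has_vector_derivative_diff variation_has_vector_derivative flow_has_vector_derivative)
    then show ?thesis by (simp add: deriv_simps)
  qed
  fix t :: real assume "0 \<le> t"
  have "norm (N (flow N t y) - N (flow N t x) - N' (flow N t x) (flow N t y - flow N t x))
      \<le> K * (norm (flow N t y - flow N t x))\<^sup>2" by (rule field_remainder)
  also have "\<dots> \<le> K * (exp (a * t) * norm (y - x))\<^sup>2"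
    using K_nonneg \<open>0 \<le> t\<close> by (intro mult_left_mono power_mono flow_dist) auto
  finally show "norm (N (flow N t y) - N (flow N t x) - N' (flow N t x) (flow N t y - flow N t x))
      \<le> K * (norm (y - x))\<^sup>2 * (exp (a * t) * exp (a * t))" by (simp add: power2_eq_square mult_ac)
qed (use assms in auto)

lemma flow_has_derivative:
  assumes "0 \<le> t"
  shows "(flow N t has_derivative (\<lambda>h. variation x h t)) (at x)"
  unfolding has_derivative_at_alt
proof (intro conjI allI impI)
  show "bounded_linear (\<lambda>h. variation x h t)"
    using linear_variation[OF assms] by (simp add: linear_conv_bounded_linear)
  fix e :: real assume "0 < e"
  define C where "C = K * (exp (a * t) * expint a t)"
  have "0 \<le> C" using K_nonneg expint_nonneg[OF assms] by (simp add: C_def)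
  have "norm (flow N t y - flow N t x - variation x (y - x) t) \<le> e * norm (y - x)"
    if "norm (y - x) < e / (C + 1)" for y
  proof -
    have "C * norm (y - x) \<le> (C + 1) * (e / (C + 1))"
      using that \<open>0 \<le> C\<close> by (intro mult_mono) auto
    then have "C * norm (y - x) * norm (y - x) \<le> e * norm (y - x)"
      using \<open>0 \<le> C\<close> by (intro mult_right_mono) auto
    then show ?thesis
      using flow_remainder[OF assms, of y x] by (simp add: C_def power2_eq_square mult_ac)
  qed
  moreover have "0 < e / (C + 1)" using \<open>0 < e\<close> \<open>0 \<le> C\<close> by simp
  ultimately show "\<exists>d>0. \<forall>y. norm (y - x) < d \<longrightarrow>
      norm (flow N t y - flow N t x - variation x (y - x) t) \<le> e * norm (y - x)" by blast
qed

text \<open>Joint continuity in the initial point and the time, needed for the measurability of the integrand of the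
Gramian.\<close>

lemma continuous_on_variation_compose:
  assumes p: "continuous_on S p" and s: "continuous_on S s" "\<And>t. t \<in> S \<Longrightarrow> 0 \<le> s t"
  shows "continuous_on S (\<lambda>t. variation (p t) h (s t))"
  unfolding continuous_on_def
proof
  fix t assume t: "t \<in> S"
  let ?V = "\<lambda>t. variation (p t) h (s t)"
  have "((\<lambda>r. ?V r - ?V t) \<longlongrightarrow> 0) (at t within S)"
  proof (rule Lim_null_comparison)
    let ?g = "\<lambda>r. K * norm (p r - p t) * norm h * (exp (a * s r) * expint a (s r))
      + norm (variation (p t) h (s r) - ?V t)"
    have "\<forall>\<^sub>F r in at t within S. r \<in> S" by (simp add: eventually_at_filter)
    then show "\<forall>\<^sub>F r in at t within S. norm (?V r - ?V t) \<le> ?g r"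
    proof eventually_elim
      case (elim r)
      have "norm (?V r - ?V t) \<le> norm (?V r - variation (p t) h (s r)) + norm (variation (p t) h (s r) - ?V t)"
        by (rule order_trans[OF _ norm_triangle_ineq]) simp
      then show ?case using variation_dist[OF s(2)[OF elim], of "p r" h "p t"] by linarith
    qed
    have "continuous_on S (\<lambda>r. expint a (s r))"
      by (rule continuous_on_compose2[OF continuous_on_expint[of UNIV] s(1)]) simp
    moreover have "continuous_on S (\<lambda>r. variation (p t) h (s r))"
      by (rule continuous_on_compose2[OF continuous_on_variation[of UNIV] s(1)]) simp
    ultimately have "continuous_on S ?g"
      by (intro continuous_intros p s)
    then have "(?g \<longlongrightarrow> ?g t) (at t within S)" using t unfolding continuous_on_def by blast
    then show "(?g \<longlongrightarrow> 0) (at t within S)" by simp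
  qed
  then show "(?V \<longlongrightarrow> ?V t) (at t within S)" by (rule Lim_null[THEN iffD2])
qed

end

section \<open>Spectral norms and essentially bounded functions\<close>

lemma spectral_norm_nonneg: "0 \<le> spectral_norm A"
  unfolding spectral_norm_def by (rule onorm_pos_le) simp

lemma norm_matrix_vector_le: "norm (A *v x) \<le> spectral_norm A * norm x"
  unfolding spectral_norm_def by (rule onorm) simp

lemma spectral_norm_le: "0 \<le> c \<Longrightarrow> (\<And>x. norm (A *v x) \<le> c * norm x) \<Longrightarrow> spectral_norm A \<le> c"
  unfolding spectral_norm_def by (rule onorm_bound)

lemma spectral_norm_add_le: "spectral_norm (A + A') \<le> spectral_norm A + spectral_norm A'"
proof (rule spectral_norm_le)
  fix x
  have "norm ((A + A') *v x) \<le> norm (A *v x) + norm (A' *v x)"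
    by (simp add: matrix_vector_mult_add_rdistrib norm_triangle_ineq)
  also have "\<dots> \<le> spectral_norm A * norm x + spectral_norm A' * norm x"
    by (intro add_mono norm_matrix_vector_le)
  finally show "norm ((A + A') *v x) \<le> (spectral_norm A + spectral_norm A') * norm x"
    by (simp add: algebra_simps)
qed (simp add: spectral_norm_nonneg)

lemma spectral_norm_mult_le: "spectral_norm (A ** A') \<le> spectral_norm A * spectral_norm A'"
proof (rule spectral_norm_le)
  fix x
  have "norm ((A ** A') *v x) \<le> spectral_norm A * norm (A' *v x)"
    by (simp add: matrix_vector_mul_assoc[symmetric] norm_matrix_vector_le)
  also have "\<dots> \<le> spectral_norm A * (spectral_norm A' * norm x)"
    by (intro mult_left_mono norm_matrix_vector_le spectral_norm_nonneg)
  finally show "norm ((A ** A') *v x) \<le> spectral_norm A * spectral_norm A' * norm x"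
    by (simp add: mult.assoc)
qed (simp add: spectral_norm_nonneg)

text \<open>From \<open>\<bar>A\<^sup>T x\<bar>\<^sup>2 = x \<bullet> A A\<^sup>T x \<le> \<bar>x\<bar> \<parallel>A\<parallel> \<bar>A\<^sup>T x\<bar>\<close>.\<close>

lemma spectral_norm_transpose_le: "spectral_norm (transpose A) \<le> spectral_norm A"
proof (rule spectral_norm_le)
  fix x
  let ?y = "transpose A *v x"
  have "(norm ?y)\<^sup>2 = x \<bullet> (A *v ?y)"
    by (simp add: power2_norm_eq_inner dot_lmul_matrix)
  also have "\<dots> \<le> norm x * norm (A *v ?y)" by (rule norm_cauchy_schwarz)
  also have "\<dots> \<le> norm x * (spectral_norm A * norm ?y)"
    by (intro mult_left_mono norm_matrix_vector_le) simp
  finally have "norm ?y * norm ?y \<le> (spectral_norm A * norm x) * norm ?y"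
    by (simp add: power2_eq_square mult_ac)
  then show "norm ?y \<le> spectral_norm A * norm x"
    by (cases "norm ?y = 0") (auto simp: spectral_norm_nonneg)
qed (simp add: spectral_norm_nonneg)

lemma spectral_norm_gram_le:
  fixes X Y :: "real ^ 'n ^ 'm" and B :: "real ^ 'k ^ 'n"
  shows "spectral_norm (X ** B ** transpose B ** transpose Y)
    \<le> spectral_norm X * (spectral_norm B)\<^sup>2 * spectral_norm Y"
proof -
  have "spectral_norm (X ** B ** transpose B ** transpose Y)
      \<le> spectral_norm (X ** B ** transpose B) * spectral_norm (transpose Y)" by (rule spectral_norm_mult_le)
  also have "\<dots> \<le> (spectral_norm (X ** B) * spectral_norm (transpose B)) * spectral_norm (transpose Y)"
    by (intro mult_right_mono spectral_norm_mult_le spectral_norm_nonneg)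
  also have "\<dots> \<le> ((spectral_norm X * spectral_norm B) * spectral_norm B) * spectral_norm Y"
    by (intro mult_mono mult_nonneg_nonneg spectral_norm_mult_le spectral_norm_transpose_le spectral_norm_nonneg)
  finally show ?thesis by (simp add: power2_eq_square mult_ac)
qed

text \<open>Telescoping: \<open>J B B\<^sup>T J\<^sup>T - J' B B\<^sup>T J'\<^sup>T\<close> is \<open>(J - J') B B\<^sup>T J\<^sup>T + J' B B\<^sup>T (J - J')\<^sup>T\<close>.\<close>

lemma spectral_norm_gram_diff_le:
  fixes J J' :: "real ^ 'n ^ 'm" and B :: "real ^ 'k ^ 'n"
  shows "spectral_norm (J ** B ** transpose B ** transpose J - J' ** B ** transpose B ** transpose J')
    \<le> spectral_norm (J - J') * (spectral_norm B)\<^sup>2 * (spectral_norm J + spectral_norm J')"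
proof -
  \<comment> \<open>Only the matrix \<open>J\<close> on the left and the right is expanded as \<open>?X + J\'\<close>.\<close>
  let ?X = "J - J'"
  have "transpose J = transpose ?X + transpose J'"
    by (simp add: transpose_def vec_eq_iff)
  moreover have "J ** M = ?X ** M + J' ** M" for M :: "real ^ 'm ^ 'n"
    by (simp add: matrix_matrix_mult_def vec_eq_iff sum.distrib[symmetric] algebra_simps)
  ultimately have "J ** B ** transpose B ** transpose J - J' ** B ** transpose B ** transpose J'
      = ?X ** B ** transpose B ** transpose J + J' ** B ** transpose B ** transpose ?X"
    by (simp add: matrix_mul_assoc[symmetric] matrix_add_ldistrib)
  then have "spectral_norm (J ** B ** transpose B ** transpose J - J' ** B ** transpose B ** transpose J')
      \<le> spectral_norm ((J - J') ** B ** transpose B ** transpose J)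
        + spectral_norm (J' ** B ** transpose B ** transpose (J - J'))"
    by (simp add: spectral_norm_add_le)
  also have "\<dots> \<le> spectral_norm (J - J') * (spectral_norm B)\<^sup>2 * spectral_norm J + spectral_norm J' * (spectral_norm B)\<^sup>2 * spectral_norm (J - J')"
    by (intro add_mono spectral_norm_gram_le)
  finally show ?thesis by (simp add: algebra_simps)
qed

lemma AE_Ioo_imp_AE_Icc:
  fixes a b :: real
  assumes "AE t in lebesgue_on {a<..<b}. P t"
  shows "AE t in lebesgue. t \<in> {a..b} \<longrightarrow> P t"
proof -
  have "AE t in lebesgue. t \<in> {a<..<b} \<longrightarrow> P t"
    using assms by (simp add: AE_restrict_space_iff)
  moreover have "AE t in lebesgue. t \<noteq> a" "AE t in lebesgue. t \<noteq> b"
    using AE_lborel_singleton by (auto intro!: AE_completion)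
  ultimately show ?thesis by eventually_elim auto
qed

lemma Linf_AE:
  assumes "f \<in> Linf \<nu> T"
  shows "AE t in lebesgue. t \<in> {0..T} \<longrightarrow> \<nu> (f t) \<le> Linf_norm \<nu> T f"
proof (rule AE_Ioo_imp_AE_Icc)
  let ?M = "lebesgue_on {0<..<T}" and ?s = "esssup (lebesgue_on {0<..<T}) (\<lambda>t. ereal (\<nu> (f t)))"
  have "?s \<noteq> \<infinity>" using assms by (auto simp: Linf_def)
  show "AE t in ?M. \<nu> (f t) \<le> Linf_norm \<nu> T f"
    using esssup_AE[of "\<lambda>t. ereal (\<nu> (f t))" ?M]
  proof eventually_elim
    case (elim t)
    then show ?case using \<open>?s \<noteq> \<infinity>\<close>
      unfolding Linf_norm_def by (cases ?s) auto
  qed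
qed

text \<open>A negative essential supremum of a nonnegative function would force the interval to be a null set; this
is where \<open>0 < T\<close> enters.\<close>

lemma Linf_norm_nonneg:
  assumes "f \<in> Linf \<nu> T" "\<And>x. 0 \<le> \<nu> x" "0 < T"
  shows "0 \<le> Linf_norm \<nu> T f"
proof (rule ccontr)
  assume "\<not> ?thesis"
  with Linf_AE[OF assms(1)] have "AE t in lebesgue. t \<notin> {0..T}"
    by (auto elim!: eventually_mono dest: order_trans[OF assms(2)])
  then have "{0..T} \<in> null_sets lebesgue" by (simp add: AE_iff_null_sets)
  then show False using \<open>0 < T\<close> by (simp add: null_sets_def)
qed

lemma Linf_norm_normI:
  fixes f :: "real \<Rightarrow> 'a::euclidean_space"
  assumes f: "f \<in> borel_measurable (lebesgue_on {0<..<T})"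
    and "AE t in lebesgue. t \<in> {0..T} \<longrightarrow> norm (f t) \<le> c"
  shows "f \<in> Linf norm T"
proof -
  have "AE t in lebesgue_on {0<..<T}. ereal (norm (f t)) \<le> ereal c"
    using assms(2) by (auto simp: AE_restrict_space_iff elim!: eventually_mono)
  then have "esssup (lebesgue_on {0<..<T}) (\<lambda>t. ereal (norm (f t))) \<le> ereal c"
    using f by (intro esssup_I) auto
  then show ?thesis using f by (auto simp: Linf_def dest: le_less_trans)
qed

lemma Linf_diff:
  fixes u v :: "real \<Rightarrow> 'a::euclidean_space"
  assumes u: "u \<in> Linf norm T" and v: "v \<in> Linf norm T"
  shows "(\<lambda>t. u t - v t) \<in> Linf norm T"
proof (rule Linf_norm_normI)
  show "(\<lambda>t. u t - v t) \<in> borel_measurable (lebesgue_on {0<..<T})"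
    using u v by (intro borel_measurable_diff) (auto simp: Linf_def)
  show "AE t in lebesgue. t \<in> {0..T} \<longrightarrow> norm (u t - v t) \<le> Linf_norm norm T u + Linf_norm norm T v"
    using Linf_AE[OF u] Linf_AE[OF v]
    by eventually_elim (auto intro: norm_triangle_le_diff)
qed

text \<open>Essentially bounded functions are only known to be measurable on the open interval; the two end points are
added by hand.\<close>

lemma set_integrable_ess_bounded:
  fixes f :: "real \<Rightarrow> 'a::euclidean_space"
  assumes f: "f \<in> borel_measurable (lebesgue_on {0<..<T})"
    and bound: "AE t in lebesgue. t \<in> {0..T} \<longrightarrow> norm (f t) \<le> c"
    and "0 < T"
  shows "set_integrable lebesgue {0..T} f"
proof -
  have "(\<lambda>t. indicator {0<..<T} t *\<^sub>R f t) \<in> borel_measurable lebesgue"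
    using f by (simp add: borel_measurable_restrict_space_iff)
  moreover have "(\<lambda>t. indicator {r} t *\<^sub>R f r) \<in> borel_measurable lebesgue" for r
    by (intro borel_measurable_scaleR borel_measurable_indicator borel_measurable_const) auto
  ultimately have "(\<lambda>t. indicator {0<..<T} t *\<^sub>R f t + indicator {0} t *\<^sub>R f 0 + indicator {T} t *\<^sub>R f T)
      \<in> borel_measurable lebesgue"
    by (intro borel_measurable_add)
  also have "(\<lambda>t. indicator {0<..<T} t *\<^sub>R f t + indicator {0} t *\<^sub>R f 0 + indicator {T} t *\<^sub>R f T)
      = (\<lambda>t. indicator {0..T} t *\<^sub>R f t)"
    using \<open>0 < T\<close> by (intro ext) (auto simp: indicator_def)
  finally have meas: "(\<lambda>t. indicator {0..T} t *\<^sub>R f t) \<in> borel_measurable lebesgue" .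
  show ?thesis
    unfolding set_integrable_def
  proof (rule integrableI_bounded_set[where A = "{0..T}" and B = c])
    show "AE t in lebesgue. t \<in> {0..T} \<longrightarrow> norm (indicator {0..T} t *\<^sub>R f t) \<le> c"
      using bound by eventually_elim auto
  qed (use meas in \<open>auto simp: emeasure_lborel_Icc_eq\<close>)
qed

lemma set_integral_increment_le:
  fixes g :: "real \<Rightarrow> 'a::euclidean_space"
  assumes int: "set_integrable lebesgue {0..T} g"
    and bound: "AE t in lebesgue. t \<in> {0..T} \<longrightarrow> norm (g t) \<le> c"
    and st: "0 \<le> s" "s \<le> t" "t \<le> T"
  shows "norm ((LINT r:{0..t}|lebesgue. g r) - (LINT r:{0..s}|lebesgue. g r)) \<le> c * (t - s)"
proof -
  have sub: "set_integrable lebesgue A g" if "A \<subseteq> {0..T}" "A \<in> sets lebesgue" for A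
    by (rule set_integrable_subset[OF int that(2,1)])
  have i: "set_integrable lebesgue {0..s} g" "set_integrable lebesgue {s<..t} g"
    using st by (auto intro!: sub)
  have "{0..t} = {0..s} \<union> {s<..t}" "{0..s} \<inter> {s<..t} = {}" using st by auto
  then have "(LINT r:{0..t}|lebesgue. g r) - (LINT r:{0..s}|lebesgue. g r) = (LINT r:{s<..t}|lebesgue. g r)"
    using set_integral_Un[of "{0..s}" "{s<..t}" lebesgue g, OF _ i] by simp
  also have "norm \<dots> \<le> (LINT r:{s<..t}|lebesgue. norm (g r))"
    using st by (intro set_integral_norm_bound sub) auto
  also have "\<dots> \<le> (LINT r:{s<..t}|lebesgue. c)"
  proof (rule set_integral_mono_AE)
    show "set_integrable lebesgue {s<..t} (\<lambda>r. norm (g r))"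
      using st by (intro set_integrable_norm sub) auto
    show "set_integrable lebesgue {s<..t} (\<lambda>r. c)"
      by (rule set_integrable_subset[OF absolutely_integrable_continuous_real[of s t]]) auto
    show "AE r\<in>{s<..t} in lebesgue. norm (g r) \<le> c"
      using bound by eventually_elim (use st in auto)
  qed
  also have "\<dots> = c * (t - s)" using st by (simp add: set_integral_const)
  finally show ?thesis .
qed

section \<open>Trajectories of the control system\<close>

lemma bounded_bilinear_matrix_vector_mult:
  "bounded_bilinear (\<lambda>(A :: real ^ 'k ^ 'n) x. A *v x)"
proof -
  have "bilinear (\<lambda>(A :: real ^ 'k ^ 'n) x. A *v x)"
    by (auto simp: bilinear_def matrix_vector_mult_add_rdistrib scaleR_matrix_vector_assoc
        matrix_vector_right_distrib matrix_vector_mult_scaleR intro!: linearI)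
  then show ?thesis by (simp add: bilinear_conv_bounded_bilinear)
qed

lemma borel_measurable_matrix_vector_mult:
  fixes B :: "'a \<Rightarrow> real ^ 'k ^ 'n"
  assumes "B \<in> borel_measurable M" "u \<in> borel_measurable M"
  shows "(\<lambda>t. B t *v u t) \<in> borel_measurable M"
proof -
  have "continuous_on (UNIV :: ((real ^ 'k ^ 'n) \<times> (real ^ 'k)) set) (\<lambda>p. fst p *v snd p)"
    by (intro bounded_bilinear.continuous_on[OF bounded_bilinear_matrix_vector_mult]
        continuous_on_fst continuous_on_snd continuous_on_id)
  from borel_measurable_continuous_Pair[OF assms this] show ?thesis by simp
qed

lemma control_term:
  fixes B :: "real \<Rightarrow> real ^ 'k ^ 'n" and u :: "real \<Rightarrow> real ^ 'k"
  assumes B: "B \<in> Linf spectral_norm T" and u: "u \<in> Linf norm T" and "0 < T"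
  shows set_integrable_control: "set_integrable lebesgue {0..T} (\<lambda>t. B t *v u t)"
    and AE_norm_control: "AE t in lebesgue. t \<in> {0..T} \<longrightarrow>
      norm (B t *v u t) \<le> Linf_norm spectral_norm T B * Linf_norm norm T u"
proof -
  show AE: "AE t in lebesgue. t \<in> {0..T} \<longrightarrow>
      norm (B t *v u t) \<le> Linf_norm spectral_norm T B * Linf_norm norm T u"
    using Linf_AE[OF B] Linf_AE[OF u]
  proof eventually_elim
    case (elim t)
    show ?case
    proof
      assume t: "t \<in> {0..T}"
      have "norm (B t *v u t) \<le> spectral_norm (B t) * norm (u t)" by (rule norm_matrix_vector_le)
      also have "\<dots> \<le> Linf_norm spectral_norm T B * Linf_norm norm T u"
        using elim t Linf_norm_nonneg[OF B spectral_norm_nonneg \<open>0 < T\<close>]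
        by (intro mult_mono) auto
      finally show "norm (B t *v u t) \<le> Linf_norm spectral_norm T B * Linf_norm norm T u" .
    qed
  qed
  show "set_integrable lebesgue {0..T} (\<lambda>t. B t *v u t)"
  proof (rule set_integrable_ess_bounded[OF _ AE \<open>0 < T\<close>])
    have "B \<in> borel_measurable (lebesgue_on {0<..<T})" "u \<in> borel_measurable (lebesgue_on {0<..<T})"
      using B u by (simp_all add: Linf_def)
    then show "(\<lambda>t. B t *v u t) \<in> borel_measurable (lebesgue_on {0<..<T})"
      by (rule borel_measurable_matrix_vector_mult)
  qed
qed

definition control_drift :: "(real \<Rightarrow> real ^ 'k ^ 'n) \<Rightarrow> (real \<Rightarrow> real ^ 'k) \<Rightarrow> real \<Rightarrow> real ^ 'n" where
  "control_drift B u t = (LINT s:{0..t}|lebesgue. B s *v u s)"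

lemma control_drift_increment:
  assumes "B \<in> Linf spectral_norm T" "u \<in> Linf norm T" "0 < T" "0 \<le> s" "s \<le> t" "t \<le> T"
  shows "norm (control_drift B u t - control_drift B u s)
    \<le> Linf_norm spectral_norm T B * Linf_norm norm T u * (t - s)"
proof -
  have "norm ((LINT r:{0..t}|lebesgue. B r *v u r) - (LINT r:{0..s}|lebesgue. B r *v u r))
      \<le> Linf_norm spectral_norm T B * Linf_norm norm T u * (t - s)"
  proof (rule set_integral_increment_le)
    show "set_integrable lebesgue {0..T} (\<lambda>t. B t *v u t)"
      by (rule set_integrable_control[OF assms(1,2,3)])
    show "AE t in lebesgue. t \<in> {0..T} \<longrightarrow>
        norm (B t *v u t) \<le> Linf_norm spectral_norm T B * Linf_norm norm T u"
      by (rule AE_norm_control[OF assms(1,2,3)])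
  qed (fact assms)+
  then show ?thesis by (simp only: control_drift_def)
qed

lemma control_drift_0 [simp]: "control_drift B u 0 = 0"
proof -
  have "(\<lambda>s. indicator {0} s *\<^sub>R (B s *v u s)) = (\<lambda>s. indicator {0} s *\<^sub>R (B 0 *v u 0))"
    by (intro ext) (auto simp: indicator_def)
  then show ?thesis by (simp add: control_drift_def set_lebesgue_integral_def)
qed

lemma control_drift_diff:
  assumes "B \<in> Linf spectral_norm T" "u \<in> Linf norm T" "v \<in> Linf norm T" "0 < T" "0 \<le> t" "t \<le> T"
  shows "control_drift B u t - control_drift B v t = control_drift B (\<lambda>t. u t - v t) t"
proof -
  have "set_integrable lebesgue {0..t} (\<lambda>s. B s *v w s)" if "w \<in> Linf norm T" for w
    by (rule set_integrable_subset[OF set_integrable_control]) (use assms that in auto)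
  then show ?thesis
    using assms unfolding control_drift_def
    by (subst set_integral_diff(2)[symmetric]) (auto simp: matrix_vector_mult_diff_distrib)
qed

lemma continuous_on_control_drift:
  assumes "B \<in> Linf spectral_norm T" "u \<in> Linf norm T" "0 < T"
  shows "continuous_on {0..T} (control_drift B u)"
proof -
  define C where "C = Linf_norm spectral_norm T B * Linf_norm norm T u"
  have inc: "dist (control_drift B u t) (control_drift B u s) \<le> C * dist t s"
    if "s \<in> {0..T}" "t \<in> {0..T}" for s t
    using control_drift_increment[OF assms, of s t] control_drift_increment[OF assms, of t s] that
    by (cases "s \<le> t") (auto simp: dist_norm C_def norm_minus_commute abs_if)
  have "C-lipschitz_on {0..T} (control_drift B u)"
    using inc Linf_norm_nonneg[OF assms(1) spectral_norm_nonneg assms(3)]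
      Linf_norm_nonneg[OF assms(2) norm_ge_zero assms(3)]
    by (intro lipschitz_onI) (auto simp: C_def)
  then show ?thesis by (rule lipschitz_on_continuous_on)
qed

text \<open>Splitting off the integral of the input leaves a Riemann integral of a continuous function.\<close>

lemma solves_control_iff:
  assumes N: "smooth_field N N' a L K"
    and B: "B \<in> Linf spectral_norm T" and u: "u \<in> Linf norm T" and "0 < T"
  shows "solves_control N B T x0 u x \<longleftrightarrow> continuous_on {0..T} x \<and>
    (\<forall>t\<in>{0..T}. x t = x0 + integral {0..t} (\<lambda>s. N (x s)) + control_drift B u t)"
proof -
  have "(LINT s:{0..t}|lebesgue. N (x s) + B s *v u s)
      = integral {0..t} (\<lambda>s. N (x s)) + control_drift B u t"
    if x: "continuous_on {0..T} x" and t: "t \<in> {0..T}" for t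
  proof -
    have "set_integrable lebesgue {0..t} (\<lambda>s. N (x s))"
      using t
      by (intro absolutely_integrable_continuous_real
          continuous_on_subset[OF smooth_field.continuous_on_field[OF N x]]) auto
    moreover have "set_integrable lebesgue {0..t} (\<lambda>s. B s *v u s)"
      by (rule set_integrable_subset[OF set_integrable_control[OF B u \<open>0 < T\<close>]]) (use t in auto)
    ultimately show ?thesis
      by (simp add: set_integral_add(2) set_lebesgue_integral_eq_integral(2) control_drift_def)
  qed
  then show ?thesis by (auto simp: solves_control_def add.assoc)
qed

text \<open>With \<open>w\<close> the integral of the input, \<open>y = x - w\<close> solves the classical equation \<open>y' = N (y + w t)\<close>. Freezing
\<open>w\<close> outside of \<open>[0, T]\<close> makes it continuous and bounded on the whole line.\<close>

lemma ex_solves_control: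
  assumes N: "smooth_field N N' a L K"
    and B: "B \<in> Linf spectral_norm T" and u: "u \<in> Linf norm T" and "0 < T"
  shows "\<exists>x. solves_control N B T x0 u x"
proof -
  interpret smooth_field N N' a L K by fact
  define w where "w t = control_drift B u (max 0 (min t T))" for t
  have w: "continuous_on UNIV w"
    unfolding w_def
    by (rule continuous_on_compose2[OF continuous_on_control_drift[OF B u \<open>0 < T\<close>]])
      (use \<open>0 < T\<close> in \<open>auto intro!: continuous_intros\<close>)
  have "compact (control_drift B u ` {0..T})"
    by (intro compact_continuous_image continuous_on_control_drift assms) simp
  then obtain C where C: "norm (control_drift B u t) \<le> C" if "t \<in> {0..T}" for t
    using compact_imp_bounded bounded_iff by (metis imageI)
  have "\<exists>y. y 0 = x0 \<and> (\<forall>t. (y has_vector_derivative N (y t + w t)) (at t))"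
  proof (rule picard_global[where f = "\<lambda>t y. N (y + w t)"])
    show "continuous_on UNIV (\<lambda>t. N (y t + w t))" if "continuous_on UNIV y" for y
      by (intro continuous_on_field continuous_on_add that w)
    show "norm (N (y + w t) - N (z + w t)) \<le> L * norm (y - z)" for t y z
      using field_lip[of "y + w t" "z + w t"] by simp
    show "norm (N (0 + w t)) \<le> norm (N 0) + L * C" for t
    proof -
      have "norm (w t) \<le> C" using C \<open>0 < T\<close> by (simp add: w_def)
      then have "L * norm (w t) \<le> L * C" by (rule mult_left_mono[OF _ L_nonneg])
      then show ?thesis
        using field_lip[of "w t" 0] norm_triangle_sub[of "N (w t)" "N 0"] by simp
    qed
  qed
  then obtain y where y: "y 0 = x0" "\<And>t. (y has_vector_derivative N (y t + w t)) (at t)" by blast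
  define x where "x t = y t + w t" for t
  have "continuous_on UNIV y"
    using y(2) by (intro continuous_at_imp_continuous_on ballI has_vector_derivative_continuous)
  then have "continuous_on {0..T} x"
    unfolding x_def using w by (intro continuous_on_add) (auto intro: continuous_on_subset)
  moreover have "x t = x0 + integral {0..t} (\<lambda>s. N (x s)) + control_drift B u t" if t: "t \<in> {0..T}" for t
  proof -
    have "((\<lambda>s. N (x s)) has_integral y t - y 0) {0..t}"
      unfolding x_def using t y(2)
      by (intro fundamental_theorem_of_calculus) (auto intro: has_vector_derivative_at_within)
    then have "integral {0..t} (\<lambda>s. N (x s)) = y t - x0" using y(1) by (simp add: integral_unique)
    then show ?thesis using t by (simp add: x_def w_def)
  qed
  ultimately show ?thesis using solves_control_iff[OF assms, of x0 x] by blast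
qed

lemma trajectory_solves_control:
  assumes "smooth_field N N' a L K"
    and "B \<in> Linf spectral_norm T" "u \<in> Linf norm T" "0 < T"
  shows "solves_control N B T x0 u (trajectory N B T x0 u)"
  unfolding trajectory_def by (rule someI_ex[OF ex_solves_control[OF assms]])

lemma continuous_on_trajectory:
  assumes "smooth_field N N' a L K"
    and "B \<in> Linf spectral_norm T" "u \<in> Linf norm T" "0 < T"
  shows "continuous_on {0..T} (trajectory N B T x0 u)"
  using trajectory_solves_control[OF assms] by (simp add: solves_control_def)

text \<open>The drift difference \<open>w\<close> enters only through its Lipschitz constant \<open>C\<close>, so the norm is compared with
the solution \<open>C * expint a t\<close> of \<open>m' = a m + C\<close>.\<close>

lemma trajectory_dist:
  assumes N: "smooth_field N N' a L K"
    and B: "B \<in> Linf spectral_norm T" and u: "u \<in> Linf norm T" and v: "v \<in> Linf norm T" and "0 < T"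
    and t: "0 \<le> t" "t \<le> T"
  shows "norm (trajectory N B T x0 u t - trajectory N B T x0 v t)
    \<le> Linf_norm spectral_norm T B * Linf_norm norm T (\<lambda>t. u t - v t) * expint a t"
proof -
  interpret smooth_field N N' a L K by fact
  define C where "C = Linf_norm spectral_norm T B * Linf_norm norm T (\<lambda>t. u t - v t)"
  define X where "X w = trajectory N B T x0 w" for w
  define Y where "Y w s = integral {0..s} (\<lambda>s. N (X w s))" for w s
  have X: "continuous_on {0..T} (X w)" if "w \<in> Linf norm T" for w
    unfolding X_def by (rule continuous_on_trajectory[OF N B that \<open>0 < T\<close>])
  have eq: "X w s = x0 + Y w s + control_drift B w s" if "w \<in> Linf norm T" "s \<in> {0..T}" for w s
    using trajectory_solves_control[OF N B that(1) \<open>0 < T\<close>, of x0] that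
    unfolding solves_control_iff[OF N B that(1) \<open>0 < T\<close>] X_def Y_def by blast
  have Y: "(Y w has_vector_derivative N (X w s)) (at_right s)"
    if w: "w \<in> Linf norm T" and s: "0 \<le> s" "s < T" for w s
  proof -
    have "(Y w has_vector_derivative N (X w s)) (at s within {0..T})"
      unfolding Y_def
      by (rule integral_has_vector_derivative[OF continuous_on_field[OF X[OF w]]]) (use s in auto)
    then have "(Y w has_vector_derivative N (X w s)) (at s within {s..T})"
      by (rule has_vector_derivative_within_subset) (use s in auto)
    then show ?thesis using s by (simp add: at_within_Icc_at_right)
  qed
  have "norm (X u t - X v t) \<le> C * expint a t"
  proof (rule logarithmic_norm_growth[where z = "\<lambda>s. X u s - X v s" and y = "\<lambda>s. Y u s - Y v s"
        and w = "\<lambda>s. control_drift B (\<lambda>t. u t - v t) s" and F = "\<lambda>s. N (X u s) - N (X v s)"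
        and G = "\<lambda>_. 0" and \<beta> = C and a = a and L = L and b = "\<lambda>_. C" and m = "\<lambda>s. C * expint a s"])
    show "continuous_on {0..t} (\<lambda>s. X u s - X v s)"
      using X[OF u] X[OF v] t by (intro continuous_on_diff) (auto elim: continuous_on_subset)
    show "continuous_on {0..t} (\<lambda>s. C * expint a s)" by (intro continuous_intros)
    show "((\<lambda>s. Y u s - Y v s) has_vector_derivative N (X u s) - N (X v s) + 0) (at_right s)"
      if "0 \<le> s" "s < t" for s
      using Y[OF u, of s] Y[OF v, of s] that t by (simp add: has_vector_derivative_diff)
    show "X u s - X v s = Y u s - Y v s + control_drift B (\<lambda>t. u t - v t) s"
      if "0 \<le> s" "s \<le> t" for s
      using eq[OF u, of s] eq[OF v, of s] control_drift_diff[OF B u v \<open>0 < T\<close>, of s] that t by simp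
    show "norm (control_drift B (\<lambda>t. u t - v t) r - control_drift B (\<lambda>t. u t - v t) s) \<le> C * (r - s)"
      if "0 \<le> s" "s \<le> r" "r \<le> t" for r s
      unfolding C_def using that t by (intro control_drift_increment B Linf_diff u v \<open>0 < T\<close>) auto
    show "((\<lambda>s. C * expint a s) has_real_derivative a * (C * expint a s) + C) (at_right s)" for s
      by (auto intro!: derivative_eq_intros simp: exp_eq_expint algebra_simps)
    have "X u 0 = x0" "X v 0 = x0" using eq[OF u, of 0] eq[OF v, of 0] \<open>0 < T\<close> by (simp_all add: Y_def)
    then show "norm (X u 0 - X v 0) \<le> C * expint a 0" by simp
  qed (use t field_one_sided_lip field_lip in simp_all)
  then show ?thesis by (simp add: X_def C_def)
qed

section \<open>The two integrals that produce the constants\<close>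

lemma expint_add: "expint a (s + t) = expint a s + exp (a * s) * expint a t"
  by (cases "a = 0") (simp_all add: expint_def distrib_left exp_add add_divide_distrib[symmetric] diff_divide_distrib[symmetric] algebra_simps)

text \<open>With \<open>e = exp (a * t) = 1 + a E\<close>, the stated primitive is \<open>(3 a E + 4) E\<^sup>3 / 6\<close>, and \<open>E' = e\<close>.\<close>

lemma has_integral_backward_kernel:
  assumes "0 \<le> T"
  shows "((\<lambda>t. 2 * (exp (a * t))\<^sup>2 * expint a t * expint a t) has_integral
    (3 * exp (a * T) + 1) / 6 * expint a T ^ 3) {0..T}"
proof -
  define F where "F t = (3 * exp (a * t) + 1) / 6 * expint a t ^ 3" for t
  have "(F has_real_derivative 2 * (exp (a * t))\<^sup>2 * expint a t * expint a t) (at t within {0..T})" for t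
  proof -
    have eq: "F = (\<lambda>t. (3 * a * expint a t + 4) / 6 * expint a t ^ 3)"
      by (auto simp: F_def exp_eq_expint)
    show ?thesis
      unfolding eq
      by (auto intro!: derivative_eq_intros
          simp: exp_eq_expint power2_eq_square power3_eq_cube field_simps)
  qed
  then have "((\<lambda>t. 2 * (exp (a * t))\<^sup>2 * expint a t * expint a t) has_integral F T - F 0) {0..T}"
    using assms
    by (intro fundamental_theorem_of_calculus)
      (auto simp: has_real_derivative_iff_has_vector_derivative[symmetric])
  then show ?thesis by (simp add: F_def)
qed

text \<open>Put \<open>p = expint a (T - t)\<close> and \<open>R = expint a T\<close>. Then \<open>dp = - exp (a * (T - t)) dt\<close> and the addition
formula gives \<open>exp (a * (T - t)) * expint a t = R - p\<close>, so the integral is that of \<open>2 p (R - p)\<close> over \<open>[0, R]\<close>.\<close>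

lemma has_integral_forward_kernel:
  assumes "0 \<le> T"
  shows "((\<lambda>t. 2 * (exp (a * (T - t)))\<^sup>2 * expint a (T - t) * expint a t) has_integral
    expint a T ^ 3 / 3) {0..T}"
proof -
  define F where "F t = 2 / 3 * expint a (T - t) ^ 3 - expint a T * expint a (T - t) ^ 2" for t
  have "(F has_real_derivative 2 * (exp (a * (T - t)))\<^sup>2 * expint a (T - t) * expint a t) (at t within {0..T})" for t
  proof -
    have E: "((\<lambda>t. expint a (T - t)) has_real_derivative - exp (a * (T - t))) (at t within {0..T})"
      by (rule DERIV_chain2[where f = "expint a" and g = "\<lambda>t. T - t" and Db = "-1",
            OF expint_has_real_derivative, simplified])
        (auto intro!: derivative_eq_intros)
    have split: "expint a T = expint a (T - t) + exp (a * (T - t)) * expint a t"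
      using expint_add[of a "T - t" t] by simp
    have "(F has_real_derivative 2 / 3 * (3 * expint a (T - t) ^ 2 * - exp (a * (T - t)))
        - expint a T * (2 * expint a (T - t) * - exp (a * (T - t)))) (at t within {0..T})"
      unfolding F_def by (auto intro!: derivative_eq_intros E)
    also have "2 / 3 * (3 * expint a (T - t) ^ 2 * - exp (a * (T - t)))
        - expint a T * (2 * expint a (T - t) * - exp (a * (T - t)))
        = 2 * (exp (a * (T - t)))\<^sup>2 * expint a (T - t) * expint a t"
      unfolding split by (simp add: power2_eq_square algebra_simps)
    finally show ?thesis .
  qed
  then have "((\<lambda>t. 2 * (exp (a * (T - t)))\<^sup>2 * expint a (T - t) * expint a t) has_integral F T - F 0) {0..T}"
    using assms
    by (intro fundamental_theorem_of_calculus)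
      (auto simp: has_real_derivative_iff_has_vector_derivative[symmetric])
  moreover have "F T - F 0 = expint a T ^ 3 / 3"
    by (simp add: F_def power2_eq_square power3_eq_cube)
  ultimately show ?thesis by simp
qed

section \<open>Gramians along trajectories\<close>

lemma norm_le_spectral_norm:
  fixes A :: "real ^ 'n ^ 'm"
  shows "norm A \<le> real CARD('m) * real CARD('n) * spectral_norm A"
proof -
  have entry: "\<bar>A $ i $ j\<bar> \<le> spectral_norm A" for i j
    unfolding spectral_norm_def by (rule matrix_component_le_onorm)
  have "norm A \<le> (\<Sum>i\<in>UNIV. norm (A $ i))" by (simp add: norm_vec_def L2_set_le_sum)
  also have "\<dots> \<le> (\<Sum>i\<in>(UNIV :: 'm set). \<Sum>j\<in>(UNIV :: 'n set). spectral_norm A)"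
    by (intro sum_mono order_trans[OF norm_le_l1_cart] entry)
  finally show ?thesis by (simp add: mult.assoc)
qed

lemma bounded_linear_mult_vec: "bounded_linear (\<lambda>A. A *v (h :: real ^ 'n) :: real ^ 'm)"
  by (rule bounded_bilinear.bounded_linear_left[OF bounded_bilinear_matrix_vector_mult])

lemma matrix_set_integral_mult_vec:
  fixes M :: "real \<Rightarrow> real ^ 'n ^ 'm"
  assumes "set_integrable lebesgue S M"
  shows "set_integrable lebesgue S (\<lambda>t. M t *v h)"
    and "(LINT t:S|lebesgue. M t) *v h = (LINT t:S|lebesgue. M t *v h)"
  using integrable_bounded_linear[OF bounded_linear_mult_vec assms[unfolded set_integrable_def], of h]
    integral_bounded_linear[OF bounded_linear_mult_vec assms[unfolded set_integrable_def], of h]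
  by (simp_all add: set_integrable_def set_lebesgue_integral_def scaleR_matrix_vector_assoc)

text \<open>Applied to each vector separately, the integral of matrices becomes one of vectors, to which the triangle
inequality applies in the Euclidean norm; the norm of the matrix type itself would lose a factor.\<close>

lemma spectral_norm_set_integral_le:
  fixes M :: "real \<Rightarrow> real ^ 'n ^ 'm"
  assumes M: "set_integrable lebesgue S M" and c: "set_integrable lebesgue S c"
    and nonneg: "\<And>t. t \<in> S \<Longrightarrow> 0 \<le> c t"
    and bound: "AE t in lebesgue. t \<in> S \<longrightarrow> spectral_norm (M t) \<le> c t"
  shows "spectral_norm (LINT t:S|lebesgue. M t) \<le> (LINT t:S|lebesgue. c t)"
proof (rule spectral_norm_le)
  show "0 \<le> (LINT t:S|lebesgue. c t)"
    unfolding set_lebesgue_integral_def using nonneg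
    by (intro integral_nonneg_AE always_eventually) (auto simp: indicator_def)
  fix h
  have "norm ((LINT t:S|lebesgue. M t) *v h) \<le> (LINT t:S|lebesgue. norm (M t *v h))"
    unfolding matrix_set_integral_mult_vec(2)[OF M]
    by (intro set_integral_norm_bound matrix_set_integral_mult_vec(1) M)
  also have "\<dots> \<le> (LINT t:S|lebesgue. c t * norm h)"
  proof (rule set_integral_mono_AE)
    show "set_integrable lebesgue S (\<lambda>t. norm (M t *v h))"
      by (intro set_integrable_norm matrix_set_integral_mult_vec(1) M)
    show "set_integrable lebesgue S (\<lambda>t. c t * norm h)" using c by (rule set_integrable_mult_left)
    show "AE t\<in>S in lebesgue. norm (M t *v h) \<le> c t * norm h"
      using bound
    proof eventually_elim
      case (elim t)
      show ?case
      proof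
        assume "t \<in> S"
        then have "spectral_norm (M t) * norm h \<le> c t * norm h" using elim by (intro mult_right_mono) auto
        then show "norm (M t *v h) \<le> c t * norm h" using norm_matrix_vector_le[of "M t" h] by linarith
      qed
    qed
  qed
  also have "\<dots> = (LINT t:S|lebesgue. c t) * norm h" by simp
  finally show "norm ((LINT t:S|lebesgue. M t) *v h) \<le> (LINT t:S|lebesgue. c t) * norm h" .
qed

text \<open>Pointwise, \<open>x \<bullet> J B B\<^sup>T J\<^sup>T x = \<bar>B\<^sup>T J\<^sup>T x\<bar>\<^sup>2\<close>; symmetry and positivity pass to the integral.\<close>

lemma set_integral_gram_sym_psd:
  fixes J :: "real \<Rightarrow> real ^ 'n ^ 'n" and B :: "real \<Rightarrow> real ^ 'k ^ 'n"
  assumes M: "set_integrable lebesgue S (\<lambda>t. J t ** B t ** transpose (B t) ** transpose (J t))"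
  shows "(LINT t:S|lebesgue. J t ** B t ** transpose (B t) ** transpose (J t)) \<in> sym_psd"
proof -
  let ?M = "\<lambda>t. J t ** B t ** transpose (B t) ** transpose (J t)"
  have "linear (transpose :: real ^ 'n ^ 'n \<Rightarrow> real ^ 'n ^ 'n)"
    by (intro linearI) (auto simp: transpose_def vec_eq_iff)
  then have "bounded_linear (transpose :: real ^ 'n ^ 'n \<Rightarrow> real ^ 'n ^ 'n)"
    by (simp add: linear_conv_bounded_linear)
  then have "transpose (LINT t:S|lebesgue. ?M t) = integral\<^sup>L lebesgue (\<lambda>t. transpose (indicator S t *\<^sub>R ?M t))"
    unfolding set_lebesgue_integral_def
    by (rule integral_bounded_linear[OF _ M[unfolded set_integrable_def], symmetric])
  also have "\<dots> = (LINT t:S|lebesgue. ?M t)"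
    unfolding set_lebesgue_integral_def
    by (rule arg_cong[where f = "integral\<^sup>L lebesgue"], rule ext)
      (simp add: transpose_scalar matrix_transpose_mul matrix_mul_assoc)
  finally have sym: "transpose (LINT t:S|lebesgue. ?M t) = (LINT t:S|lebesgue. ?M t)" .
  have "0 \<le> x \<bullet> ((LINT t:S|lebesgue. ?M t) *v x)" for x
  proof -
    have pos: "0 \<le> x \<bullet> (?M t *v x)" for t
    proof -
      let ?y = "transpose (B t) *v (transpose (J t) *v x)"
      have "x \<bullet> (?M t *v x) = x \<bullet> (J t *v (B t *v ?y))"
        by (simp only: matrix_vector_mul_assoc matrix_mul_assoc)
      also have "\<dots> = (transpose (J t) *v x) \<bullet> (B t *v ?y)"
        by (simp add: dot_lmul_matrix)
      also have "\<dots> = ?y \<bullet> ?y" by (simp add: dot_lmul_matrix)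
      finally show ?thesis by simp
    qed
    have "x \<bullet> ((LINT t:S|lebesgue. ?M t) *v x) = (LINT t:S|lebesgue. x \<bullet> (?M t *v x))"
      unfolding matrix_set_integral_mult_vec(2)[OF M]
      unfolding set_lebesgue_integral_def
      using integral_inner_right[OF matrix_set_integral_mult_vec(1)[OF M, of x, unfolded set_integrable_def], of x]
      by simp
    also have "\<dots> \<ge> 0"
      unfolding set_lebesgue_integral_def using pos
      by (intro integral_nonneg_AE always_eventually) (auto simp: indicator_def)
    finally show ?thesis .
  qed
  with sym show ?thesis by (simp add: sym_psd_def)
qed

lemma jacobian_flow:
  fixes N :: "real ^ 'n \<Rightarrow> real ^ 'n"
  assumes N: "smooth_field N N' a L K" and "0 \<le> t"
  shows "jacobian (flow N t) (at x) = (\<chi> i j. smooth_field.variation N N' x (axis j 1) t $ i)"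
    and "jacobian (flow N t) (at x) *v h = smooth_field.variation N N' x h t"
proof -
  interpret smooth_field N N' a L K by fact
  have eq: "frechet_derivative (flow N t) (at x) = (\<lambda>h. variation x h t)"
    using frechet_derivative_at[OF flow_has_derivative[OF \<open>0 \<le> t\<close>]] by simp
  show "jacobian (flow N t) (at x) = (\<chi> i j. variation x (axis j 1) t $ i)"
    by (simp add: jacobian_def eq matrix_def)
  show "jacobian (flow N t) (at x) *v h = variation x h t"
    unfolding jacobian_def eq
    by (rule fun_cong[OF matrix_vector_mul(2)[OF linear_variation[OF \<open>0 \<le> t\<close>]]])
qed

lemma spectral_norm_jacobian_flow_le:
  fixes N :: "real ^ 'n \<Rightarrow> real ^ 'n"
  assumes N: "smooth_field N N' a L K" and "0 \<le> t"
  shows "spectral_norm (jacobian (flow N t) (at x)) \<le> exp (a * t)"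
  using smooth_field.norm_variation_le[OF N \<open>0 \<le> t\<close>]
  by (intro spectral_norm_le) (simp_all add: jacobian_flow(2)[OF assms])

lemma spectral_norm_jacobian_flow_diff_le:
  fixes N :: "real ^ 'n \<Rightarrow> real ^ 'n"
  assumes N: "smooth_field N N' a L K" and "0 \<le> t"
  shows "spectral_norm (jacobian (flow N t) (at x) - jacobian (flow N t) (at y))
    \<le> K * norm (x - y) * (exp (a * t) * expint a t)"
proof (rule spectral_norm_le)
  show "0 \<le> K * norm (x - y) * (exp (a * t) * expint a t)"
    using smooth_field.K_nonneg[OF N] expint_nonneg[OF \<open>0 \<le> t\<close>] by simp
  fix h
  show "norm ((jacobian (flow N t) (at x) - jacobian (flow N t) (at y)) *v h)
    \<le> K * norm (x - y) * (exp (a * t) * expint a t) * norm h"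
    using smooth_field.variation_dist[OF assms, of x h y]
    by (simp add: matrix_vector_mult_diff_rdistrib jacobian_flow(2)[OF assms] mult_ac)
qed

lemma continuous_on_jacobian_flow:
  fixes N :: "real ^ 'n \<Rightarrow> real ^ 'n"
  assumes N: "smooth_field N N' a L K"
    and "continuous_on S p" "continuous_on S s" and s: "\<And>t. t \<in> S \<Longrightarrow> 0 \<le> s t"
  shows "continuous_on S (\<lambda>t. jacobian (flow N (s t)) (at (p t)))"
proof -
  have "continuous_on S (\<lambda>t. (\<chi> i j. smooth_field.variation N N' (p t) (axis j 1) (s t) $ i))"
    by (intro continuous_on_vec_lambda continuous_on_component smooth_field.continuous_on_variation_compose[OF N] assms)
  then show ?thesis
    by (rule continuous_on_eq) (simp add: jacobian_flow(1)[OF N s])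
qed

text \<open>The integrand is measurable as a continuous function of \<open>J\<close> and \<open>B\<close>. The bound on spectral norms has to be
carried over to the norm of the matrix type by \<open>norm_le_spectral_norm\<close>.\<close>

lemma gram_integrable:
  fixes J :: "real \<Rightarrow> real ^ 'n ^ 'm" and B :: "real \<Rightarrow> real ^ 'k ^ 'n"
  assumes J: "continuous_on {0..T} J" and B: "B \<in> Linf spectral_norm T" and "0 < T"
    and bound: "\<And>t. t \<in> {0..T} \<Longrightarrow> spectral_norm (J t) \<le> c"
  shows "set_integrable lebesgue {0..T} (\<lambda>t. J t ** B t ** transpose (B t) ** transpose (J t))"
proof (rule set_integrable_ess_bounded[OF _ _ \<open>0 < T\<close>])
  let ?M = "\<lambda>t. J t ** B t ** transpose (B t) ** transpose (J t)"
  have "J \<in> borel_measurable (lebesgue_on {0<..<T})"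
    by (intro continuous_imp_measurable_on_sets_lebesgue continuous_on_subset[OF J]) auto
  moreover have "B \<in> borel_measurable (lebesgue_on {0<..<T})" using B by (simp add: Linf_def)
  moreover have "continuous_on UNIV (\<lambda>p :: (real ^ 'n ^ 'm) \<times> (real ^ 'k ^ 'n).
      fst p ** snd p ** transpose (snd p) ** transpose (fst p))"
    unfolding matrix_matrix_mult_def transpose_def by (intro continuous_intros)
  ultimately show "?M \<in> borel_measurable (lebesgue_on {0<..<T})"
    by (rule borel_measurable_continuous_Pair[where H = "\<lambda>A C. A ** C ** transpose C ** transpose A"])
  let ?C = "real CARD('m) * real CARD('m) * (c * (Linf_norm spectral_norm T B)\<^sup>2 * c)"
  show "AE t in lebesgue. t \<in> {0..T} \<longrightarrow> norm (?M t) \<le> ?C"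
    using Linf_AE[OF B]
  proof eventually_elim
    case (elim t)
    show ?case
    proof
      assume t: "t \<in> {0..T}"
      have "0 \<le> c" using bound[OF t] spectral_norm_nonneg order_trans by blast
      have "spectral_norm (?M t) \<le> spectral_norm (J t) * (spectral_norm (B t))\<^sup>2 * spectral_norm (J t)"
        by (rule spectral_norm_gram_le)
      also have "\<dots> \<le> c * (Linf_norm spectral_norm T B)\<^sup>2 * c"
        using elim t bound[OF t] \<open>0 \<le> c\<close>
        by (intro mult_mono power_mono) (auto simp: spectral_norm_nonneg)
      finally have "real CARD('m) * real CARD('m) * spectral_norm (?M t) \<le> ?C"
        by (intro mult_left_mono) auto
      then show "norm (?M t) \<le> ?C"
        using norm_le_spectral_norm[of "?M t"] by linarith
    qed
  qed
qed

text \<open>The field \<open>N\<close> drives the trajectories while \<open>F\<close> generates the flow in the integrand: \<open>F = N\<close> with \<open>s t = T - t\<close>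
for the final time, and \<open>F = - N\<close> with \<open>s t = t\<close> for the initial time. The constant \<open>\<alpha>'\<close> allows to replace
the growth rate of the trajectories by the one of the reversed flow.\<close>

lemma gram_along_trajectory:
  fixes N F :: "real ^ 'n \<Rightarrow> real ^ 'n" and B :: "real \<Rightarrow> real ^ 'k ^ 'n" and s :: "real \<Rightarrow> real" and x0 :: "real ^ 'n"
  assumes N: "smooth_field N N' \<alpha> L K" and F: "smooth_field F F' a L' K'"
    and s: "continuous_on {0..T} s" "\<And>t. t \<in> {0..T} \<Longrightarrow> 0 \<le> s t"
    and B: "B \<in> Linf spectral_norm T" and "0 < T"
  defines "J \<equiv> \<lambda>w t. jacobian (flow F (s t)) (at (trajectory N B T x0 w t))"
  defines "G \<equiv> \<lambda>w. LINT t:{0..T}|lebesgue. J w t ** B t ** transpose (B t) ** transpose (J w t)"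
  shows gram_along_trajectory_sym_psd: "u \<in> Linf norm T \<Longrightarrow> G u \<in> sym_psd"
    and gram_along_trajectory_diff_le: "\<lbrakk>u \<in> Linf norm T; v \<in> Linf norm T; \<alpha> \<le> \<alpha>';
      ((\<lambda>t. 2 * (exp (a * s t))\<^sup>2 * expint a (s t) * expint \<alpha>' t) has_integral I) {0..T}\<rbrakk> \<Longrightarrow>
      spectral_norm (G u - G v)
        \<le> K' * Linf_norm spectral_norm T B ^ 3 * Linf_norm norm T (\<lambda>t. u t - v t) * I"
proof -
  define b where "b = Linf_norm spectral_norm T B"
  have "0 \<le> b" unfolding b_def by (rule Linf_norm_nonneg[OF B spectral_norm_nonneg \<open>0 < T\<close>])
  have "0 \<le> K'" by (rule smooth_field.K_nonneg[OF F])
  have J: "spectral_norm (J w t) \<le> exp (a * s t)" if "t \<in> {0..T}" for w t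
    unfolding J_def by (rule spectral_norm_jacobian_flow_le[OF F s(2)[OF that]])
  have cont_exp: "continuous_on {0..T} (\<lambda>t. exp (a * s t))"
    using s(1) by (intro continuous_intros)
  then have "compact ((\<lambda>t. exp (a * s t)) ` {0..T})" by (intro compact_continuous_image) auto
  then obtain c where c: "norm (exp (a * s t)) \<le> c" if "t \<in> {0..T}" for t
    using compact_imp_bounded bounded_iff by (metis imageI)
  have int: "set_integrable lebesgue {0..T} (\<lambda>t. J w t ** B t ** transpose (B t) ** transpose (J w t))"
    if w: "w \<in> Linf norm T" for w
  proof (rule gram_integrable[OF _ B \<open>0 < T\<close>])
    show "continuous_on {0..T} (J w)"
      unfolding J_def
      by (rule continuous_on_jacobian_flow[OF F continuous_on_trajectory[OF N B w \<open>0 < T\<close>] s])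
    show "spectral_norm (J w t) \<le> c" if "t \<in> {0..T}" for t
      using J[OF that, of w] c[OF that] by simp
  qed
  show "G u \<in> sym_psd" if "u \<in> Linf norm T"
    unfolding G_def by (rule set_integral_gram_sym_psd[OF int[OF that]])
  assume u: "u \<in> Linf norm T" and v: "v \<in> Linf norm T" and "\<alpha> \<le> \<alpha>'"
    and I: "((\<lambda>t. 2 * (exp (a * s t))\<^sup>2 * expint a (s t) * expint \<alpha>' t) has_integral I) {0..T}"
  define U where "U = Linf_norm norm T (\<lambda>t. u t - v t)"
  have "0 \<le> U" unfolding U_def by (rule Linf_norm_nonneg[OF Linf_diff[OF u v] norm_ge_zero \<open>0 < T\<close>])
  let ?M = "\<lambda>w t. J w t ** B t ** transpose (B t) ** transpose (J w t)"
  define k where "k t = 2 * (exp (a * s t))\<^sup>2 * expint a (s t) * expint \<alpha>' t" for t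
  have "continuous_on {0..T} (\<lambda>t. expint a (s t))"
    by (rule continuous_on_compose2[OF continuous_on_expint[of UNIV] s(1)]) simp
  then have k: "set_integrable lebesgue {0..T} (\<lambda>t. K' * b ^ 3 * U * k t)"
    unfolding k_def
    by (intro absolutely_integrable_continuous_real continuous_on_mult continuous_on_power
        continuous_on_const continuous_on_expint cont_exp)
  have "G u - G v = (LINT t:{0..T}|lebesgue. ?M u t - ?M v t)"
    unfolding G_def by (rule set_integral_diff(2)[OF int[OF u] int[OF v], symmetric])
  also have "spectral_norm \<dots> \<le> (LINT t:{0..T}|lebesgue. K' * b ^ 3 * U * k t)"
  proof (rule spectral_norm_set_integral_le[OF set_integral_diff(1)[OF int[OF u] int[OF v]] k])
    show "0 \<le> K' * b ^ 3 * U * k t" if "t \<in> {0..T}" for t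
      using that \<open>0 \<le> K'\<close> \<open>0 \<le> b\<close> \<open>0 \<le> U\<close> s(2)[OF that]
      by (auto simp: k_def intro!: mult_nonneg_nonneg expint_nonneg)
    show "AE t in lebesgue. t \<in> {0..T} \<longrightarrow> spectral_norm (?M u t - ?M v t) \<le> K' * b ^ 3 * U * k t"
      using Linf_AE[OF B]
    proof eventually_elim
      case (elim t)
      show ?case
      proof
        assume t: "t \<in> {0..T}"
        let ?e = "exp (a * s t)" and ?E = "expint a (s t)"
        have "0 \<le> ?E" "0 \<le> expint \<alpha>' t" using s(2)[OF t] t by (auto intro: expint_nonneg)
        have "norm (trajectory N B T x0 u t - trajectory N B T x0 v t) \<le> b * U * expint \<alpha> t"
          unfolding b_def U_def using t by (intro trajectory_dist[OF N B u v \<open>0 < T\<close>]) auto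
        also have "\<dots> \<le> b * U * expint \<alpha>' t"
          using \<open>0 \<le> b\<close> \<open>0 \<le> U\<close> \<open>\<alpha> \<le> \<alpha>'\<close> t by (intro mult_left_mono expint_mono) auto
        finally have "K' * norm (trajectory N B T x0 u t - trajectory N B T x0 v t) * (?e * ?E)
            \<le> K' * (b * U * expint \<alpha>' t) * (?e * ?E)"
          using \<open>0 \<le> K'\<close> \<open>0 \<le> ?E\<close> by (intro mult_right_mono mult_left_mono) auto
        then have diff: "spectral_norm (J u t - J v t) \<le> K' * (b * U * expint \<alpha>' t) * (?e * ?E)"
          unfolding J_def using spectral_norm_jacobian_flow_diff_le[OF F s(2)[OF t]] by (rule order_trans[rotated])
        have "spectral_norm (?M u t - ?M v t)
            \<le> spectral_norm (J u t - J v t) * (spectral_norm (B t))\<^sup>2 * (spectral_norm (J u t) + spectral_norm (J v t))"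
          by (rule spectral_norm_gram_diff_le)
        also have "\<dots> \<le> (K' * (b * U * expint \<alpha>' t) * (?e * ?E)) * b\<^sup>2 * (?e + ?e)"
          using elim t diff J[OF t, of u] J[OF t, of v] \<open>0 \<le> b\<close> \<open>0 \<le> U\<close> \<open>0 \<le> K'\<close> \<open>0 \<le> ?E\<close> \<open>0 \<le> expint \<alpha>' t\<close>
          by (intro mult_mono power_mono add_mono) (auto simp: b_def spectral_norm_nonneg)
        also have "\<dots> = K' * b ^ 3 * U * k t"
          by (simp add: k_def power2_eq_square power3_eq_cube)
        finally show "spectral_norm (?M u t - ?M v t) \<le> K' * b ^ 3 * U * k t" .
      qed
    qed
  qed
  also have "\<dots> = K' * b ^ 3 * U * I"
  proof -
    have "((\<lambda>t. K' * b ^ 3 * U * k t) has_integral K' * b ^ 3 * U * I) {0..T}"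
      unfolding k_def by (rule has_integral_mult_right[OF I])
    then show ?thesis by (simp only: set_lebesgue_integral_eq_integral(2)[OF k] integral_unique)
  qed
  finally show "spectral_norm (G u - G v)
      \<le> K' * Linf_norm spectral_norm T B ^ 3 * Linf_norm norm T (\<lambda>t. u t - v t) * I"
    by (simp add: b_def U_def)
qed

section \<open>The constants of the Hopfield field\<close>

lemma smooth_bounded_derivs:
  assumes "smooth_bounded f"
  shows "(f has_real_derivative deriv f x) (at x)"
    and "(deriv f has_real_derivative deriv (deriv f) x) (at x)"
    and "bounded (range (deriv f))" and "bounded (range (deriv (deriv f)))"
proof -
  have diff: "(deriv ^^ n) f differentiable at x" and bdd: "bounded (range ((deriv ^^ n) f))" for n x
    using assms by (auto simp: smooth_bounded_def)
  show "(f has_real_derivative deriv f x) (at x)"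
    using diff[where n = 0] by (simp add: DERIV_deriv_iff_real_differentiable)
  show "(deriv f has_real_derivative deriv (deriv f) x) (at x)"
    using diff[where n = 1] by (simp add: DERIV_deriv_iff_real_differentiable)
  show "bounded (range (deriv f))" using bdd[of 1] by simp
  show "bounded (range (deriv (deriv f)))" using bdd[of 2] by (simp add: numeral_2_eq_2)
qed

lemma has_derivative_vec_componentwise:
  fixes f :: "real ^ 'n \<Rightarrow> real ^ 'm"
  assumes "\<And>i. ((\<lambda>x. f x $ i) has_derivative (\<lambda>h. f' h $ i)) (at x)"
  shows "(f has_derivative f') (at x)"
proof (subst has_derivative_componentwise_within, rule ballI)
  fix b :: "real ^ 'm" assume "b \<in> Basis"
  then obtain i where "b = axis i 1" by (auto simp: Basis_vec_def)
  then show "((\<lambda>x. f x \<bullet> b) has_derivative (\<lambda>h. f' h \<bullet> b)) (at x)"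
    using assms[of i] by (simp add: inner_axis)
qed

definition componentwise_deriv :: "('n \<Rightarrow> real \<Rightarrow> real) \<Rightarrow> real ^ 'n \<Rightarrow> real ^ 'n \<Rightarrow> real ^ 'n" where
  "componentwise_deriv \<sigma> x h = (\<chi> j. deriv (\<sigma> j) (x $ j) * h $ j)"

definition componentwise_deriv2 ::
    "('n \<Rightarrow> real \<Rightarrow> real) \<Rightarrow> real ^ 'n \<Rightarrow> real ^ 'n \<Rightarrow> real ^ 'n \<Rightarrow> real ^ 'n" where
  "componentwise_deriv2 \<sigma> x h k = (\<chi> j. deriv (deriv (\<sigma> j)) (x $ j) * k $ j * h $ j)"

lemma has_derivative_vec_nth: "((\<lambda>x. x $ i) has_derivative (\<lambda>h. h $ i)) (at x)"
  by (rule bounded_linear_imp_has_derivative[OF bounded_linear_vec_nth])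

lemma componentwise_has_derivative:
  assumes "\<And>j. smooth_bounded (\<sigma> j)"
  shows "(componentwise \<sigma> has_derivative componentwise_deriv \<sigma> x) (at x)"
proof (rule has_derivative_vec_componentwise)
  fix i
  have "(\<sigma> i has_derivative (\<lambda>h. deriv (\<sigma> i) (x $ i) * h)) (at (x $ i))"
    using smooth_bounded_derivs(1)[OF assms] by (simp add: has_field_derivative_def)
  from has_derivative_compose[OF has_derivative_vec_nth this]
  show "((\<lambda>x. componentwise \<sigma> x $ i) has_derivative (\<lambda>h. componentwise_deriv \<sigma> x h $ i)) (at x)"
    by (simp add: componentwise_def componentwise_deriv_def)
qed

lemma componentwise_deriv_has_derivative:
  assumes "\<And>j. smooth_bounded (\<sigma> j)"
  shows "((\<lambda>x. componentwise_deriv \<sigma> x h) has_derivative componentwise_deriv2 \<sigma> x h) (at x)"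
proof (rule has_derivative_vec_componentwise)
  fix i
  have "(deriv (\<sigma> i) has_derivative (\<lambda>k. deriv (deriv (\<sigma> i)) (x $ i) * k)) (at (x $ i))"
    using smooth_bounded_derivs(2)[OF assms] by (simp add: has_field_derivative_def)
  from has_derivative_mult_left[OF has_derivative_compose[OF has_derivative_vec_nth this], of "h $ i"]
  show "((\<lambda>x. componentwise_deriv \<sigma> x h $ i) has_derivative (\<lambda>k. componentwise_deriv2 \<sigma> x h k $ i)) (at x)"
    by (simp add: componentwise_deriv_def componentwise_deriv2_def)
qed

lemma frechet_componentwise:
  assumes "\<And>j. smooth_bounded (\<sigma> j)"
  shows "frechet_derivative (componentwise \<sigma>) (at x) = componentwise_deriv \<sigma> x"
  by (rule frechet_derivative_at[OF componentwise_has_derivative[OF assms], symmetric])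

lemma jacobian_componentwise:
  assumes "\<And>j. smooth_bounded (\<sigma> j)"
  shows "jacobian (componentwise \<sigma>) (at x) *v h = componentwise_deriv \<sigma> x h"
  unfolding jacobian_def frechet_componentwise[OF assms]
  by (rule fun_cong[OF matrix_vector_mul(2)[OF has_derivative_linear[OF componentwise_has_derivative[OF assms]]]])

lemma second_derivative_componentwise:
  assumes "\<And>j. smooth_bounded (\<sigma> j)"
  shows "second_derivative (componentwise \<sigma>) x h k = componentwise_deriv2 \<sigma> x h k"
  unfolding second_derivative_def frechet_componentwise[OF assms]
  by (rule fun_cong[OF frechet_derivative_at[OF componentwise_deriv_has_derivative[OF assms], symmetric]])

lemma norm_vec_mult_le:
  fixes c h :: "real ^ 'n"
  assumes "\<And>j. \<bar>c $ j\<bar> \<le> M"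
  shows "norm (\<chi> j. c $ j * h $ j) \<le> M * norm h"
proof -
  have "0 \<le> M" using assms abs_ge_zero order_trans by blast
  have "norm (\<chi> j. c $ j * h $ j) \<le> norm (M *\<^sub>R h)"
  proof (rule norm_le_componentwise_cart)
    fix i
    show "norm ((\<chi> j. c $ j * h $ j) $ i) \<le> norm ((M *\<^sub>R h) $ i)"
      using assms[of i] \<open>0 \<le> M\<close> by (simp add: abs_mult mult_right_mono)
  qed
  then show ?thesis using \<open>0 \<le> M\<close> by simp
qed

lemma uniform_bound:
  fixes f :: "'n::finite \<Rightarrow> real \<Rightarrow> real"
  assumes "\<And>j. bounded (range (f j))"
  obtains M where "0 \<le> M" "\<And>j x. \<bar>f j x\<bar> \<le> M"
proof -
  have "bounded (\<Union>j. range (f j))" using assms by (intro bounded_UN) auto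
  then obtain M where M: "\<bar>f j x\<bar> \<le> M" for j x by (auto simp: bounded_iff)
  then have "0 \<le> M" using abs_ge_zero order_trans by blast
  with M that show thesis by blast
qed

text \<open>The supremum in \<^const>\<open>sigma'_sup\<close> dominates its members because the derivatives of \<open>\<sigma>\<close> are uniformly
bounded.\<close>

lemma norm_sigma_deriv_le:
  assumes "\<And>j. smooth_bounded (\<sigma> j)"
  shows "norm (W *v componentwise_deriv \<sigma> x h) \<le> sigma'_sup W \<sigma> * norm h"
proof -
  obtain M where M: "0 \<le> M" "\<And>j x. \<bar>deriv (\<sigma> j) x\<bar> \<le> M"
    using uniform_bound[of "\<lambda>j. deriv (\<sigma> j)"] smooth_bounded_derivs(3)[OF assms] by blast
  let ?A = "\<lambda>x. W ** jacobian (componentwise \<sigma>) (at x)"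
  have A: "?A x *v h = W *v componentwise_deriv \<sigma> x h" for x h
    by (simp add: matrix_vector_mul_assoc[symmetric] jacobian_componentwise[OF assms])
  have "spectral_norm (?A x) \<le> spectral_norm W * M" for x
  proof (rule spectral_norm_le)
    fix h
    have "norm (?A x *v h) \<le> spectral_norm W * norm (componentwise_deriv \<sigma> x h)"
      unfolding A by (rule norm_matrix_vector_le)
    also have "norm (componentwise_deriv \<sigma> x h) \<le> M * norm h"
      using norm_vec_mult_le[of "\<chi> j. deriv (\<sigma> j) (x $ j)" M h] M(2)
      by (simp add: componentwise_deriv_def)
    finally show "norm (?A x *v h) \<le> spectral_norm W * M * norm h"
      by (simp add: mult_left_mono spectral_norm_nonneg mult.assoc)
  qed (simp add: M spectral_norm_nonneg)
  then have "bdd_above (range (\<lambda>x. spectral_norm (?A x)))" by (intro bdd_aboveI2)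
  then have "spectral_norm (?A x) \<le> sigma'_sup W \<sigma>"
    unfolding sigma'_sup_def by (intro cSUP_upper) auto
  then have "spectral_norm (?A x) * norm h \<le> sigma'_sup W \<sigma> * norm h" by (rule mult_right_mono) simp
  then show ?thesis using norm_matrix_vector_le[of "?A x" h] by (simp add: A)
qed

text \<open>As for the first derivative, both suprema, over directions and over points, are finite because the second
derivatives of \<open>\<sigma>\<close> are uniformly bounded.\<close>

lemma norm_sigma_deriv2_le:
  assumes "\<And>j. smooth_bounded (\<sigma> j)"
  shows "norm (W *v componentwise_deriv2 \<sigma> x h k) \<le> hopfield_Gamma2 W \<sigma> * norm h * norm k"
proof -
  obtain M where M: "0 \<le> M" "\<And>j x. \<bar>deriv (deriv (\<sigma> j)) x\<bar> \<le> M"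
    using uniform_bound[of "\<lambda>j. deriv (deriv (\<sigma> j))"] smooth_bounded_derivs(4)[OF assms] by blast
  let ?\<beta> = "\<lambda>x h k. W *v componentwise_deriv2 \<sigma> x h k"
  let ?C = "spectral_norm W * M"
  have bound: "norm (?\<beta> x h k) \<le> ?C * (norm h * norm k)" for x h k
  proof -
    have "\<bar>k $ j\<bar> \<le> norm k" for j using component_le_norm_cart .
    then have "norm (componentwise_deriv2 \<sigma> x h k) \<le> (M * norm k) * norm h"
      using norm_vec_mult_le[of "\<chi> j. deriv (deriv (\<sigma> j)) (x $ j) * k $ j" "M * norm k" h] M
      by (simp add: componentwise_deriv2_def abs_mult mult_mono)
    then have "spectral_norm W * norm (componentwise_deriv2 \<sigma> x h k) \<le> spectral_norm W * ((M * norm k) * norm h)"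
      by (rule mult_left_mono) (rule spectral_norm_nonneg)
    then show ?thesis
      using norm_matrix_vector_le[of W "componentwise_deriv2 \<sigma> x h k"] by (simp add: mult_ac)
  qed
  have "0 \<le> ?C" using M by (simp add: spectral_norm_nonneg)
  have quot: "norm (?\<beta> x h k) / (norm h * norm k) \<le> ?C" for x h k
    using bound[of x h k] \<open>0 \<le> ?C\<close> by (cases "h = 0 \<or> k = 0") (auto simp: divide_le_eq)
  have onorm: "norm (?\<beta> x h k) / (norm h * norm k) \<le> bilinear_onorm (?\<beta> x)" for x h k
  proof -
    have "bdd_above (range (\<lambda>(h, k). norm (?\<beta> x h k) / (norm h * norm k)))"
      using quot by (intro bdd_aboveI2[where M = ?C]) auto
    from cSUP_upper[OF UNIV_I this, of "(h, k)"] show ?thesis by (simp add: bilinear_onorm_def)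
  qed
  have "bilinear_onorm (?\<beta> x) \<le> ?C" for x
    unfolding bilinear_onorm_def using quot by (intro cSUP_least) auto
  then have "bdd_above (range (\<lambda>x. bilinear_onorm (?\<beta> x)))" by (intro bdd_aboveI2)
  then have "bilinear_onorm (?\<beta> x) \<le> hopfield_Gamma2 W \<sigma>"
    unfolding hopfield_Gamma2_def second_derivative_componentwise[OF assms] by (intro cSUP_upper) auto
  with onorm[of x h k] have q: "norm (?\<beta> x h k) / (norm h * norm k) \<le> hopfield_Gamma2 W \<sigma>" by linarith
  show ?thesis
  proof (cases "h = 0 \<or> k = 0")
    case True
    then show ?thesis using bound[of x h k] by auto
  next
    case False
    then show ?thesis using q by (simp add: divide_le_eq mult.assoc)
  qed
qed

lemma eigenvalues_diagonal:
  fixes D :: "real ^ 'n ^ 'n"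
  assumes "diagonal_positive D"
  shows "eigenvalues D = range (\<lambda>j. D $ j $ j)" and "D *v h = (\<chi> j. D $ j $ j * h $ j)"
proof -
  show Dv: "D *v h = (\<chi> j. D $ j $ j * h $ j)" for h
  proof -
    have "(\<Sum>j\<in>UNIV. D $ i $ j * h $ j) = D $ i $ i * h $ i" for i
      using assms by (subst sum.remove[of _ i]) (auto simp: diagonal_positive_def intro!: sum.neutral)
    then show ?thesis by (simp add: matrix_vector_mult_def vec_eq_iff)
  qed
  show "eigenvalues D = range (\<lambda>j. D $ j $ j)"
  proof safe
    fix l assume "l \<in> eigenvalues D"
    then obtain v where "v \<noteq> 0" "D *v v = l *\<^sub>R v" by (auto simp: eigenvalues_def)
    then obtain j where "v $ j \<noteq> 0" "D $ j $ j * v $ j = l * v $ j"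
      by (auto simp: Dv vec_eq_iff)
    then show "l \<in> range (\<lambda>j. D $ j $ j)" by auto
  next
    fix j
    have "D *v axis j 1 = (D $ j $ j) *\<^sub>R axis j 1" by (auto simp: Dv vec_eq_iff axis_def)
    moreover have "axis j (1::real) \<noteq> (0 :: real ^ 'n)" by (simp add: axis_eq_0_iff)
    ultimately show "D $ j $ j \<in> eigenvalues D" 
      unfolding eigenvalues_def by (intro CollectI exI[of _ "axis j 1"] conjI)
  qed
qed

lemma lambda_bounds:
  fixes D :: "real ^ 'n ^ 'n"
  assumes D: "diagonal_positive D"
  shows "lambda_min D * (norm h)\<^sup>2 \<le> h \<bullet> (D *v h)"
    and "norm (D *v h) \<le> lambda_max D * norm h" and "0 < lambda_max D"
proof -
  have le: "lambda_min D \<le> D $ j $ j" "D $ j $ j \<le> lambda_max D" for j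
    unfolding lambda_min_def lambda_max_def eigenvalues_diagonal(1)[OF D]
    by (auto intro!: Min_le Max_ge)
  have pos: "0 < D $ j $ j" for j using D by (simp add: diagonal_positive_def)
  show "0 < lambda_max D" using pos le(2) by (rule less_le_trans)
  have "lambda_min D * (norm h)\<^sup>2 = (\<Sum>j\<in>UNIV. lambda_min D * (h $ j * h $ j))"
    by (simp add: power2_norm_eq_inner inner_vec_def sum_distrib_left)
  also have "\<dots> \<le> (\<Sum>j\<in>UNIV. D $ j $ j * (h $ j * h $ j))"
    by (intro sum_mono mult_right_mono le) simp
  also have "\<dots> = h \<bullet> (D *v h)"
    by (simp add: eigenvalues_diagonal(2)[OF D] inner_vec_def mult_ac)
  finally show "lambda_min D * (norm h)\<^sup>2 \<le> h \<bullet> (D *v h)" .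
  have "\<bar>D $ j $ j\<bar> \<le> lambda_max D" for j using pos[of j] le(2)[of j] by simp
  then show "norm (D *v h) \<le> lambda_max D * norm h"
    using norm_vec_mult_le[of "\<chi> j. D $ j $ j" "lambda_max D" h]
    by (simp add: eigenvalues_diagonal(2)[OF D])
qed

text \<open>The linear part \<open>- D\<close> contributes \<open>- lambda_min D\<close> to the logarithmic norm but \<open>lambda_max D\<close> to the norm.
Its derivative is constant and cancels in differences of derivatives, which leaves \<open>\<Gamma>\<^sub>2\<close>.\<close>

lemma smooth_field_hopfield:
  assumes D: "diagonal_positive D" and \<sigma>: "\<And>j. smooth_bounded (\<sigma> j)"
  shows "smooth_field (hopfield D W \<sigma>) (\<lambda>x h. - (D *v h) + W *v componentwise_deriv \<sigma> x h)
    (hopfield_Gamma D W \<sigma>) (hopfield_Gamma1 D W \<sigma>) (hopfield_Gamma2 W \<sigma>)"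
proof
  fix x y h :: "real ^ 'a"
  have mv: "((\<lambda>x. A *v f x) has_derivative (\<lambda>h. A *v f' h)) (at x)"
    if "(f has_derivative f') (at x)" for A :: "real ^ 'a ^ 'a" and f f' and x :: "real ^ 'a"
    using that by (rule bounded_linear.has_derivative[OF matrix_vector_mul_bounded_linear])
  show "(hopfield D W \<sigma> has_derivative (\<lambda>h. - (D *v h) + W *v componentwise_deriv \<sigma> x h)) (at x)"
    unfolding hopfield_def[abs_def]
    by (intro has_derivative_add has_derivative_minus mv has_derivative_ident componentwise_has_derivative \<sigma>)
  have W: "norm (W *v componentwise_deriv \<sigma> x h) \<le> sigma'_sup W \<sigma> * norm h"
    by (rule norm_sigma_deriv_le[OF \<sigma>])
  have "h \<bullet> (W *v componentwise_deriv \<sigma> x h) \<le> norm h * (sigma'_sup W \<sigma> * norm h)"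
    using norm_cauchy_schwarz[of h "W *v componentwise_deriv \<sigma> x h"] mult_left_mono[OF W norm_ge_zero[of h]]
    by linarith
  then show "h \<bullet> (- (D *v h) + W *v componentwise_deriv \<sigma> x h) \<le> hopfield_Gamma D W \<sigma> * (norm h)\<^sup>2"
    using lambda_bounds(1)[OF D, of h]
    by (simp add: hopfield_Gamma_def inner_add_right power2_eq_square algebra_simps)
  show "norm (- (D *v h) + W *v componentwise_deriv \<sigma> x h) \<le> hopfield_Gamma1 D W \<sigma> * norm h"
    using norm_triangle_ineq[of "- (D *v h)" "W *v componentwise_deriv \<sigma> x h"] W lambda_bounds(2)[OF D, of h]
    by (simp add: hopfield_Gamma1_def algebra_simps)
  have "norm (W *v componentwise_deriv \<sigma> x h - W *v componentwise_deriv \<sigma> y h)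
      \<le> (hopfield_Gamma2 W \<sigma> * norm h) * norm (x - y)"
  proof (rule differentiable_bound[where S = UNIV and f' = "\<lambda>x k. W *v componentwise_deriv2 \<sigma> x h k"])
    fix z
    show "((\<lambda>x. W *v componentwise_deriv \<sigma> x h) has_derivative (\<lambda>k. W *v componentwise_deriv2 \<sigma> z h k)) (at z within UNIV)"
      by (intro mv componentwise_deriv_has_derivative \<sigma>)
    have *: "norm (W *v componentwise_deriv2 \<sigma> z h k) \<le> hopfield_Gamma2 W \<sigma> * norm h * norm k" for k
      by (rule norm_sigma_deriv2_le[OF \<sigma>])
    have "0 \<le> hopfield_Gamma2 W \<sigma> * norm h"
      using order_trans[OF norm_ge_zero *[of "axis undefined 1"]] by simp
    then show "onorm (\<lambda>k. W *v componentwise_deriv2 \<sigma> z h k) \<le> hopfield_Gamma2 W \<sigma> * norm h"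
      using * by (rule onorm_bound)
  qed auto
  then show "norm ((- (D *v h) + W *v componentwise_deriv \<sigma> x h) - (- (D *v h) + W *v componentwise_deriv \<sigma> y h))
      \<le> hopfield_Gamma2 W \<sigma> * norm (x - y) * norm h"
    by (simp add: mult_ac)
qed

text \<open>The order lets the growth rate of the trajectories be replaced by that of the reversed flow; positivity
excludes the degenerate case in \<^const>\<open>expint\<close> for the initial time.\<close>

lemma hopfield_Gamma_bounds:
  assumes D: "diagonal_positive D" and \<sigma>: "\<And>j. smooth_bounded (\<sigma> j)"
  shows "hopfield_Gamma D W \<sigma> \<le> hopfield_Gamma1 D W \<sigma>" and "0 < hopfield_Gamma1 D W \<sigma>"
proof -
  have "0 \<le> sigma'_sup W \<sigma>"
    using order_trans[OF norm_ge_zero norm_sigma_deriv_le[OF \<sigma>, where W = W and x = 0 and h = "axis undefined 1"]] by simp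
  then show "0 < hopfield_Gamma1 D W \<sigma>" using lambda_bounds(3)[OF D] by (simp add: hopfield_Gamma1_def)
  have "0 \<le> lambda_min D"
    unfolding lambda_min_def eigenvalues_diagonal(1)[OF D]
    using D by (auto simp: diagonal_positive_def intro: less_imp_le)
  then show "hopfield_Gamma D W \<sigma> \<le> hopfield_Gamma1 D W \<sigma>"
    using lambda_bounds(3)[OF D] by (simp add: hopfield_Gamma_def hopfield_Gamma1_def)
qed

section \<open>The Gramian estimates\<close>

theorem proposition3p29:
  fixes T :: real
    and D W :: "real ^ 'd ^ 'd"
    and \<sigma> :: "'d \<Rightarrow> real \<Rightarrow> real"
    and B :: "real \<Rightarrow> real ^ 'k ^ 'd"
    and x0 :: "real ^ 'd"
  assumes "0 < T"
    and "diagonal_positive D"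
    and "\<And>j. smooth_bounded (\<sigma> j)"
    and "B \<in> Linf spectral_norm T"
  defines "N \<equiv> hopfield D W \<sigma>"
    and "\<Gamma> \<equiv> hopfield_Gamma D W \<sigma>"
    and "\<Gamma>1 \<equiv> hopfield_Gamma1 D W \<sigma>"
    and "\<Gamma>2 \<equiv> hopfield_Gamma2 W \<sigma>"
    and "B_inf \<equiv> Linf_norm spectral_norm T B"
  shows "(\<forall>\<tau>\<in>{0, T}. \<forall>u\<in>Linf norm T. gramian N B T x0 \<tau> u \<in> sym_psd) \<and>
    (\<forall>u\<in>Linf norm T. \<forall>v\<in>Linf norm T.
       spectral_norm (gramian N B T x0 0 u - gramian N B T x0 0 v)
         \<le> \<Gamma>2 * B_inf ^ 3 / 6 * (3 * exp (\<Gamma>1 * T) + 1) * ((exp (\<Gamma>1 * T) - 1) / \<Gamma>1) ^ 3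
             * Linf_norm norm T (\<lambda>t. u t - v t)) \<and>
    (\<forall>u\<in>Linf norm T. \<forall>v\<in>Linf norm T.
       spectral_norm (gramian N B T x0 T u - gramian N B T x0 T v)
         \<le> (if \<Gamma> \<noteq> 0
             then \<Gamma>2 * B_inf ^ 3 / 3 * ((exp (\<Gamma> * T) - 1) / \<Gamma>) ^ 3
             else \<Gamma>2 * B_inf ^ 3 * T ^ 3 / 3)
             * Linf_norm norm T (\<lambda>t. u t - v t))"
proof -
  define N' where "N' x h = - (D *v h) + W *v componentwise_deriv \<sigma> x h" for x h
  have N: "smooth_field N N' \<Gamma> \<Gamma>1 \<Gamma>2"
    unfolding N_def N'_def[abs_def] \<Gamma>_def \<Gamma>1_def \<Gamma>2_def
    by (rule smooth_field_hopfield) fact+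
  note R = smooth_field.reversed[OF N]
  have "\<Gamma> \<le> \<Gamma>1" "0 < \<Gamma>1"
    unfolding \<Gamma>_def \<Gamma>1_def by (rule hopfield_Gamma_bounds; fact)+
  have "0 \<le> T" using \<open>0 < T\<close> by simp
  have s0: "continuous_on {0..T} (\<lambda>t. t)" "\<And>t. t \<in> {0..T} \<Longrightarrow> 0 \<le> t"
    by (auto intro: continuous_intros)
  have sT: "continuous_on {0..T} (\<lambda>t. T - t)" "\<And>t. t \<in> {0..T} \<Longrightarrow> 0 \<le> T - t"
    by (auto intro!: continuous_intros)
  have gT: "gramian N B T x0 T w = (LINT t:{0..T}|lebesgue.
      jacobian (flow N (T - t)) (at (trajectory N B T x0 w t)) ** B t ** transpose (B t)
        ** transpose (jacobian (flow N (T - t)) (at (trajectory N B T x0 w t))))" for w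
    by (simp add: gramian_def Let_def)
  have "flow N (0 - t) = flow (\<lambda>x. - N x) t" for t
    by (rule ext) (simp add: smooth_field.flow_reversed[OF N])
  then have g0: "gramian N B T x0 0 w = (LINT t:{0..T}|lebesgue.
      jacobian (flow (\<lambda>x. - N x) t) (at (trajectory N B T x0 w t)) ** B t ** transpose (B t)
        ** transpose (jacobian (flow (\<lambda>x. - N x) t) (at (trajectory N B T x0 w t))))" for w
    by (simp only: gramian_def Let_def)
  have psd: "gramian N B T x0 \<tau> u \<in> sym_psd" if "\<tau> \<in> {0, T}" "u \<in> Linf norm T" for \<tau> u
    using that(1) gram_along_trajectory_sym_psd[OF N N sT assms(4,1) that(2), of x0]
      gram_along_trajectory_sym_psd[OF N R s0 assms(4,1) that(2), of x0]
    by (auto simp: g0 gT)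
  have est0: "spectral_norm (gramian N B T x0 0 u - gramian N B T x0 0 v)
      \<le> \<Gamma>2 * B_inf ^ 3 / 6 * (3 * exp (\<Gamma>1 * T) + 1) * ((exp (\<Gamma>1 * T) - 1) / \<Gamma>1) ^ 3
          * Linf_norm norm T (\<lambda>t. u t - v t)" if "u \<in> Linf norm T" "v \<in> Linf norm T" for u v
    using gram_along_trajectory_diff_le[OF N R s0 assms(4,1) that \<open>\<Gamma> \<le> \<Gamma>1\<close>
        has_integral_backward_kernel[OF \<open>0 \<le> T\<close>], of x0] \<open>0 < \<Gamma>1\<close>
    unfolding g0 B_inf_def by (simp add: expint_def mult_ac)
  have estT: "spectral_norm (gramian N B T x0 T u - gramian N B T x0 T v)
      \<le> \<Gamma>2 * B_inf ^ 3 * Linf_norm norm T (\<lambda>t. u t - v t) * (expint \<Gamma> T ^ 3 / 3)"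
    if "u \<in> Linf norm T" "v \<in> Linf norm T" for u v
    using gram_along_trajectory_diff_le[OF N N sT assms(4,1) that order_refl
        has_integral_forward_kernel[OF \<open>0 \<le> T\<close>], of x0]
    unfolding gT B_inf_def .
  show ?thesis
  proof (intro conjI ballI)
    fix u v :: "real \<Rightarrow> real ^ 'k"
    assume "u \<in> Linf norm T" "v \<in> Linf norm T"
    from estT[OF this] show "spectral_norm (gramian N B T x0 T u - gramian N B T x0 T v)
         \<le> (if \<Gamma> \<noteq> 0
             then \<Gamma>2 * B_inf ^ 3 / 3 * ((exp (\<Gamma> * T) - 1) / \<Gamma>) ^ 3
             else \<Gamma>2 * B_inf ^ 3 * T ^ 3 / 3)
             * Linf_norm norm T (\<lambda>t. u t - v t)"
      by (cases "\<Gamma> = 0") (simp_all add: expint_def mult_ac)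
  qed (use psd est0 in blast)+
qed

end
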